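(* (i) Let $\mathbb{A}$ be an algebraic power-associative real algebra. If $\mathbb{A}$ is commutative and has no nontrivial zero-divisors, then $\mathbb{A}$ is locally complex and, equipped with its natural norm, is isometrically isomorphic to $\mathbb{R}$ or $\mathbb{C}$. Therefore, if $ab+ba=0$ implies $a=0$ or $b=0$ for all $a,b\in\mathbb{A}$, then the algebraic power-associative real algebra $\mathbb{A}$ is locally complex and, equipped with its natural norm, is isometrically isomorphic to $\mathbb{R}$ or $\mathbb{C}$. (ii) Let $\mathbb{A}$ be a power-associative real algebra. If $\mathbb{A}$ is commutative and one of the following conditions holds, then $\mathbb{A}$ is locally complex and, equipped with its natural norm, is isometrically isomorphic to $\mathbb{R}$ or $\mathbb{C}$: (a) $\mathbb{A}$ is a one-sided t-division real algebra equipped with a vector space norm relative to which the multiplication of $\mathbb{A}$ is separately continuous; (b) $\mathbb{A}$ is a real algebra equipped with a vector space norm relative to which the multiplication of $\mathbb{A}$ is separately continuous, and $\mathbb{A}$ has no nontrivial joint topological zero-divisors; (c) $\mathbb{A}$ is a real algebra equipped with a $c$-supermultiplicative vector space norm for some $c>0$ relative to which the multiplication is separately continuous (e.g., a real nearly absolute value). (iii) Let $\mathbb{A}$ be a left (resp. right) alternative topological real algebra whose topological dual separates its points. If $\mathbb{A}$ is a quasi-division algebra, equivalently, a classical division algebra, and commutative, then it is locally complex and, equipped with its natural norm, is isometrically isomorphic to $\mathbb{R}$ or $\mathbb{C}$. (iv) Let $\mathbb{A}$ be a power-associative real algebra endowed with an inner product $\langle\cdot,\cdot\rangle$ whose norm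 satisfies the identity $\|a^2\|=\|a\|^2$ on $\mathbb{A}$. Then $\mathbb{A}$ is isometrically isomorphic to $\mathbb{R}$ or $\mathbb{C}$ if it is commutative and left (resp. right) alternative, in which case the given norm of $\mathbb{A}$ coincides with its natural norm that comes from its locally complex structure. (v) Let $\mathbb{A}$ be a power-associative absolute-valued real algebra. Then $\mathbb{A}$ is isometrically isomorphic to $\mathbb{R}$ or $\mathbb{C}$ if and only if $\mathbb{A}$ is commutative, in which case the given absolute value of $\mathbb{A}$ coincides with its natural norm that comes from its locally complex structure.
   Context: Algebras are nonzero and not necessarily associative, commutative or unital. $L_ax=ax$, $R_ax=xa$. An algebra is left (resp. right) alternative if $a(ab)=(aa)b$ (resp. $a(bb)=(ab)b$) for all $a,b$; power-associative (resp. algebraic) if every subalgebra generated by one element is associative (resp. finite-dimensional). A zero-divisor is an element $a$ with $ab=0$ or $ba=0$ for some $b\ne0$; zero is the trivial one. A unital algebra is quadratic if the unital subalgebra generated by any element is at most two-dimensional. A real quadratic algebra is locally complex if the unital subalgebra generated by any element is a field extension of $\mathbb{R}$. The natural norm of a locally complex algebra is the unique vector space norm on it that comes from an inner product and satisfies $\|x^k\|=\|x\|^k$ for all $x$ and all $k\in\mathbb{N}$. An algebra is quasi-division if for every $a\neq 0$ at least one of $L_a,R_a$ is bijective; a classical division algebra if it is unital and every nonzero element is invertible ($a$ is invertible if there is a unique $a^{-1}$ with $aa^{-1}=a^{-1}a=1$); one-sided t-division (with respect to a given topology) if either all $L_a$ ($a\neq0$), or all $R_a$ ($a\ne0$), are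 bijective with continuous inverse. A topological real algebra has a Hausdorff topology such that addition and scalar multiplication are continuous, multiplication is separately continuous, and inversion is continuous on the set of invertible elements; its topological dual is the space of continuous linear functionals. A norm is $c$-supermultiplicative if $c\|a\|\|b\|\le\|ab\|$ for all $a,b$; a nearly absolute value is a submultiplicative norm that is $c$-supermultiplicative for some $c>0$; an absolute value is a norm with $\|ab\|=\|a\|\|b\|$, and an absolute-valued algebra is an algebra with an absolute value. An element $a$ is a joint topological zero-divisor if there are $b_n$ with $\|b_n\|=1$ and $\lim_n ab_n=\lim_n b_na=0$; zero is the trivial one. $\mathbb{R},\mathbb{C}$ carry the usual absolute value; "isomorphic" means as real algebras. *)

theory Defs
  imports "HOL-Analysis.Analysis" "HOL-Algebra.Ring"
begin

text \<open>
  A real algebra is a type of class \<^class>\<open>real_vector\<close> together with a product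
  \<open>m :: 'a \<Rightarrow> 'a \<Rightarrow> 'a\<close> satisfying \<^const>\<open>bilinear\<close>; nothing else is built into the product.
  Norms, inner products and topologies on it are explicit functions, resp. abstract topologies,
  because one and the same algebra is considered with several of them.
\<close>

section \<open>Algebras\<close>

definition real_algebra :: "('a::real_vector \<Rightarrow> 'a \<Rightarrow> 'a) \<Rightarrow> bool" where
  "real_algebra m \<longleftrightarrow> bilinear m \<and> (\<exists>x::'a. x \<noteq> 0)"

definition is_subalgebra :: "('a::real_vector \<Rightarrow> 'a \<Rightarrow> 'a) \<Rightarrow> 'a set \<Rightarrow> bool" where
  "is_subalgebra m S \<longleftrightarrow> subspace S \<and> (\<forall>x\<in>S. \<forall>y\<in>S. m x y \<in> S)"

definition alg_generated :: "('a::real_vector \<Rightarrow> 'a \<Rightarrow> 'a) \<Rightarrow> 'a set \<Rightarrow> 'a set" where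
  "alg_generated m X = is_subalgebra m hull X"

definition alg_commutative :: "('a \<Rightarrow> 'a \<Rightarrow> 'a) \<Rightarrow> bool" where
  "alg_commutative m \<longleftrightarrow> (\<forall>a b. m a b = m b a)"

definition left_alternative :: "('a \<Rightarrow> 'a \<Rightarrow> 'a) \<Rightarrow> bool" where
  "left_alternative m \<longleftrightarrow> (\<forall>a b. m a (m a b) = m (m a a) b)"

definition right_alternative :: "('a \<Rightarrow> 'a \<Rightarrow> 'a) \<Rightarrow> bool" where
  "right_alternative m \<longleftrightarrow> (\<forall>a b. m a (m b b) = m (m a b) b)"

definition power_associative :: "('a::real_vector \<Rightarrow> 'a \<Rightarrow> 'a) \<Rightarrow> bool" where
  "power_associative m \<longleftrightarrow>
     (\<forall>a. \<forall>x\<in>alg_generated m {a}. \<forall>y\<in>alg_generated m {a}. \<forall>z\<in>alg_generated m {a}.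
        m (m x y) z = m x (m y z))"

text \<open>Dimensions are bounded through spanning sets because \<^const>\<open>dim\<close> is 0 on
  infinite-dimensional subspaces.\<close>

definition algebraic_algebra :: "('a::real_vector \<Rightarrow> 'a \<Rightarrow> 'a) \<Rightarrow> bool" where
  "algebraic_algebra m \<longleftrightarrow> (\<forall>a. \<exists>B. finite B \<and> alg_generated m {a} \<subseteq> span B)"

definition zero_divisor :: "('a::real_vector \<Rightarrow> 'a \<Rightarrow> 'a) \<Rightarrow> 'a \<Rightarrow> bool" where
  "zero_divisor m a \<longleftrightarrow> (\<exists>b. b \<noteq> 0 \<and> (m a b = 0 \<or> m b a = 0))"

definition alg_unit :: "('a \<Rightarrow> 'a \<Rightarrow> 'a) \<Rightarrow> 'a \<Rightarrow> bool" where
  "alg_unit m e \<longleftrightarrow> (\<forall>a. m e a = a \<and> m a e = a)"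

definition quadratic_algebra :: "('a::real_vector \<Rightarrow> 'a \<Rightarrow> 'a) \<Rightarrow> bool" where
  "quadratic_algebra m \<longleftrightarrow>
     (\<exists>e. alg_unit m e \<and>
        (\<forall>x. \<exists>B. finite B \<and> card B \<le> 2 \<and> alg_generated m {e, x} \<subseteq> span B))"

definition subalgebra_ring :: "('a::real_vector \<Rightarrow> 'a \<Rightarrow> 'a) \<Rightarrow> 'a \<Rightarrow> 'a set \<Rightarrow> 'a ring" where
  "subalgebra_ring m e S = \<lparr>carrier = S, monoid.mult = m, one = e, zero = 0, add = (+)\<rparr>"

text \<open>If the unital subalgebra generated by \<open>x\<close> is a field, it is automatically an extension of
  the reals, via \<open>t \<mapsto> t *\<^sub>R e\<close>.\<close>

definition locally_complex :: "('a::real_vector \<Rightarrow> 'a \<Rightarrow> 'a) \<Rightarrow> bool" where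
  "locally_complex m \<longleftrightarrow>
     quadratic_algebra m \<and>
     (\<exists>e. alg_unit m e \<and> (\<forall>x. field (subalgebra_ring m e (alg_generated m {e, x}))))"

section \<open>Division conditions\<close>

definition quasi_division :: "('a::real_vector \<Rightarrow> 'a \<Rightarrow> 'a) \<Rightarrow> bool" where
  "quasi_division m \<longleftrightarrow> (\<forall>a. a \<noteq> 0 \<longrightarrow> bij (\<lambda>x. m a x) \<or> bij (\<lambda>x. m x a))"

definition alg_invertible :: "('a \<Rightarrow> 'a \<Rightarrow> 'a) \<Rightarrow> 'a \<Rightarrow> 'a \<Rightarrow> bool" where
  "alg_invertible m e a \<longleftrightarrow> (\<exists>!b. m a b = e \<and> m b a = e)"

definition alg_inverse :: "('a \<Rightarrow> 'a \<Rightarrow> 'a) \<Rightarrow> 'a \<Rightarrow> 'a \<Rightarrow> 'a" where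
  "alg_inverse m e a = (THE b. m a b = e \<and> m b a = e)"

definition classical_division :: "('a::real_vector \<Rightarrow> 'a \<Rightarrow> 'a) \<Rightarrow> bool" where
  "classical_division m \<longleftrightarrow> (\<exists>e. alg_unit m e \<and> (\<forall>a. a \<noteq> 0 \<longrightarrow> alg_invertible m e a))"

section \<open>Topologies\<close>

definition separately_continuous :: "'a topology \<Rightarrow> ('a \<Rightarrow> 'a \<Rightarrow> 'a) \<Rightarrow> bool" where
  "separately_continuous T m \<longleftrightarrow>
     (\<forall>a. continuous_map T T (\<lambda>x. m a x) \<and> continuous_map T T (\<lambda>x. m x a))"

definition one_sided_t_division ::
    "'a topology \<Rightarrow> ('a::real_vector \<Rightarrow> 'a \<Rightarrow> 'a) \<Rightarrow> bool" where
  "one_sided_t_division T m \<longleftrightarrow>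
     (\<forall>a. a \<noteq> 0 \<longrightarrow> bij (\<lambda>x. m a x) \<and> continuous_map T T (inv_into UNIV (\<lambda>x. m a x))) \<or>
     (\<forall>a. a \<noteq> 0 \<longrightarrow> bij (\<lambda>x. m x a) \<and> continuous_map T T (inv_into UNIV (\<lambda>x. m x a)))"

text \<open>The last clause is void if the algebra has no unit: it then has no invertible elements.\<close>

definition topological_real_algebra ::
    "'a topology \<Rightarrow> ('a::real_vector \<Rightarrow> 'a \<Rightarrow> 'a) \<Rightarrow> bool" where
  "topological_real_algebra T m \<longleftrightarrow>
     real_algebra m \<and> topspace T = UNIV \<and> Hausdorff_space T \<and>
     continuous_map (prod_topology T T) T (\<lambda>(x, y). x + y) \<and>
     continuous_map (prod_topology euclideanreal T) T (\<lambda>(c, x). c *\<^sub>R x) \<and>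
     separately_continuous T m \<and>
     (\<forall>e. alg_unit m e \<longrightarrow>
        continuous_map (subtopology T {a. alg_invertible m e a}) T (alg_inverse m e))"

definition topological_dual :: "'a topology \<Rightarrow> ('a::real_vector \<Rightarrow> real) set" where
  "topological_dual T = {f. linear f \<and> continuous_map T euclideanreal f}"

definition dual_separates_points :: "('a::real_vector) topology \<Rightarrow> bool" where
  "dual_separates_points T \<longleftrightarrow> (\<forall>x y. x \<noteq> y \<longrightarrow> (\<exists>f\<in>topological_dual T. f x \<noteq> f y))"

section \<open>Norms\<close>

definition vs_norm :: "('a::real_vector \<Rightarrow> real) \<Rightarrow> bool" where
  "vs_norm N \<longleftrightarrow>
     (\<forall>x. 0 \<le> N x) \<and> (\<forall>x. N x = 0 \<longleftrightarrow> x = 0) \<and>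
     (\<forall>x y. N (x + y) \<le> N x + N y) \<and> (\<forall>c x. N (c *\<^sub>R x) = \<bar>c\<bar> * N x)"

definition norm_topology :: "('a::real_vector \<Rightarrow> real) \<Rightarrow> 'a topology" where
  "norm_topology N = Metric_space.mtopology UNIV (\<lambda>x y. N (x - y))"

definition supermultiplicative ::
    "real \<Rightarrow> ('a \<Rightarrow> real) \<Rightarrow> ('a \<Rightarrow> 'a \<Rightarrow> 'a) \<Rightarrow> bool" where
  "supermultiplicative c N m \<longleftrightarrow> (\<forall>a b. c * N a * N b \<le> N (m a b))"

definition submultiplicative :: "('a \<Rightarrow> real) \<Rightarrow> ('a \<Rightarrow> 'a \<Rightarrow> 'a) \<Rightarrow> bool" where
  "submultiplicative N m \<longleftrightarrow> (\<forall>a b. N (m a b) \<le> N a * N b)"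

definition nearly_absolute_value ::
    "('a::real_vector \<Rightarrow> real) \<Rightarrow> ('a \<Rightarrow> 'a \<Rightarrow> 'a) \<Rightarrow> bool" where
  "nearly_absolute_value N m \<longleftrightarrow>
     vs_norm N \<and> submultiplicative N m \<and> (\<exists>c>0. supermultiplicative c N m)"

definition absolute_value ::
    "('a::real_vector \<Rightarrow> real) \<Rightarrow> ('a \<Rightarrow> 'a \<Rightarrow> 'a) \<Rightarrow> bool" where
  "absolute_value N m \<longleftrightarrow> vs_norm N \<and> (\<forall>a b. N (m a b) = N a * N b)"

definition joint_topological_zero_divisor ::
    "('a::real_vector \<Rightarrow> real) \<Rightarrow> ('a \<Rightarrow> 'a \<Rightarrow> 'a) \<Rightarrow> 'a \<Rightarrow> bool" where
  "joint_topological_zero_divisor N m a \<longleftrightarrow>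
     (\<exists>b :: nat \<Rightarrow> 'a. (\<forall>n. N (b n) = 1) \<and>
        limitin (norm_topology N) (\<lambda>n. m a (b n)) 0 sequentially \<and>
        limitin (norm_topology N) (\<lambda>n. m (b n) a) 0 sequentially)"

definition real_inner_product :: "('a::real_vector \<Rightarrow> 'a \<Rightarrow> real) \<Rightarrow> bool" where
  "real_inner_product B \<longleftrightarrow>
     bilinear B \<and> (\<forall>x y. B x y = B y x) \<and> (\<forall>x. x \<noteq> 0 \<longrightarrow> 0 < B x x)"

definition inner_product_norm :: "('a \<Rightarrow> 'a \<Rightarrow> real) \<Rightarrow> 'a \<Rightarrow> real" where
  "inner_product_norm B x = sqrt (B x x)"

text \<open>\<open>(m x ^^ k) x\<close> is the power \<open>x\<^sup>k\<^sup>+\<^sup>1\<close>, so all positive exponents are covered; the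
  exponent 0 adds nothing, since \<open>N e = 1\<close> follows from \<open>N (m e e) = (N e)\<^sup>2\<close>.\<close>

definition inner_power_norm ::
    "('a::real_vector \<Rightarrow> 'a \<Rightarrow> 'a) \<Rightarrow> ('a \<Rightarrow> real) \<Rightarrow> bool" where
  "inner_power_norm m N \<longleftrightarrow>
     vs_norm N \<and> (\<exists>B. real_inner_product B \<and> N = inner_product_norm B) \<and>
     (\<forall>x k. N ((m x ^^ k) x) = N x ^ Suc k)"

text \<open>\<open>N\<close> is the natural norm of \<open>m\<close>: the unique norm of this kind.\<close>

definition is_natural_norm ::
    "('a::real_vector \<Rightarrow> 'a \<Rightarrow> 'a) \<Rightarrow> ('a \<Rightarrow> real) \<Rightarrow> bool" where
  "is_natural_norm m N \<longleftrightarrow> inner_power_norm m N \<and> (\<forall>N'. inner_power_norm m N' \<longrightarrow> N' = N)"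

section \<open>Isometric isomorphism with the reals or the complex numbers\<close>

definition isometric_isomorphism ::
    "('a::real_vector \<Rightarrow> 'a \<Rightarrow> 'a) \<Rightarrow> ('a \<Rightarrow> real) \<Rightarrow> ('a \<Rightarrow> 'b::real_normed_algebra) \<Rightarrow> bool" where
  "isometric_isomorphism m N \<phi> \<longleftrightarrow>
     linear \<phi> \<and> bij \<phi> \<and> (\<forall>a b. \<phi> (m a b) = \<phi> a * \<phi> b) \<and> (\<forall>a. norm (\<phi> a) = N a)"

definition isometric_to_R_or_C ::
    "('a::real_vector \<Rightarrow> 'a \<Rightarrow> 'a) \<Rightarrow> ('a \<Rightarrow> real) \<Rightarrow> bool" where
  "isometric_to_R_or_C m N \<longleftrightarrow>
     (\<exists>\<phi> :: 'a \<Rightarrow> real. isometric_isomorphism m N \<phi>) \<or>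
     (\<exists>\<phi> :: 'a \<Rightarrow> complex. isometric_isomorphism m N \<phi>)"

definition naturally_R_or_C :: "('a::real_vector \<Rightarrow> 'a \<Rightarrow> 'a) \<Rightarrow> bool" where
  "naturally_R_or_C m \<longleftrightarrow>
     locally_complex m \<and> (\<exists>N. is_natural_norm m N \<and> isometric_to_R_or_C m N)"

end

theory Submission
  imports Defs "HOL-Complex_Analysis.Complex_Analysis"
    "HOL-Computational_Algebra.Fundamental_Theorem_Algebra"
begin

text \<open>
  If a power-associative algebra without solutions of \<open>ab + ba = 0\<close>, \<open>a, b \<noteq> 0\<close> satisfies a cubic
  \<open>x\<^sup>3 = 2 \<alpha> x\<^sup>2 - \<gamma> x\<close> with \<open>\<alpha>\<^sup>2 \<le> \<gamma>\<close> for every \<open>x\<close>, then every \<open>x \<noteq> 0\<close> yields an idempotent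
  \<open>(2 \<alpha> x - x\<^sup>2)/\<gamma>\<close>. A Peirce argument for the symmetrized product shows that any nonzero idempotent
  is a unit, so the algebra is quadratic, and two square roots \<open>u, v\<close> of \<open>-1\<close> agree up to sign because
  \<open>(u - v)(u + v) = 0\<close>; hence it is the reals or the complex numbers. The cubic comes from
  the fundamental theorem of algebra in (i), from an approximate complex eigenvalue of
  multiplication by \<open>x\<close> in (ii), and from Liouville's theorem applied to the resolvent in (iii). In
  (iv) the norm turns out to be multiplicative, which reduces it to (v), a case of (ii).
\<close>

section \<open>Idempotents in commutative power-associative algebras\<close>

text \<open>No unit is available at the start, so the relation sought is x (x - z)(x - cnj z) = 0,
  with \<alpha> = Re z and \<gamma> = |z|^2, rather than a quadratic one. The bound \<alpha>^2 \<le>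
  \<gamma> records that the roots are conjugate: \<gamma> = 0 would reduce the relation to x^3 = 0,
  impossible for x \<noteq> 0. The symmetrized product serves the noncommutative half of (i): it has
  the same powers, and the hypothesis says that it has no zero-divisors. The obstacle in (ii) is
  that the norm need not be complete, so inverses cannot be built as limits. The argument runs in
  complex polynomials under the seminorm induced by evaluation at x: invertibility becomes a lower
  bound together with dense range, the norm of the resolvent becomes the reciprocal of that bound,
  and a mean over the vertices of a regular polygon replaces the maximum principle. In (iii)
  inversion is continuous and the resolvent itself can be used, written with real
  coefficients.\<close>

text \<open>Turns a vector identity into a ring identity over the reals, which simplification decides.\<close>

lemma eq_by_functionals:
  fixes x y :: "'a::real_vector"
  assumes "\<And>f :: 'a \<Rightarrow> real. \<lbrakk>\<And>x y. f (x + y) = f x + f y; \<And>x y. f (x - y) = f x - f y;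
    \<And>x. f (- x) = - f x; \<And>c x. f (c *\<^sub>R x) = c * f x; f 0 = 0\<rbrakk> \<Longrightarrow> f x = f y"
  shows "x = y"
proof (rule ccontr)
  assume "x \<noteq> y"
  then have "independent {x - y}" by simp
  then obtain f :: "'a \<Rightarrow> real" where f: "linear f" "f (x - y) = 1"
    using linear_independent_extend[of "{x - y}" "\<lambda>_. 1"] by auto
  have "f x = f y"
    by (rule assms) (use f(1) in \<open>simp_all add: linear_add linear_diff linear_neg linear_scale linear_0\<close>)
  with f show False by (simp add: linear_diff)
qed

locale real_bilinear =
  fixes m :: "'a::real_vector \<Rightarrow> 'a \<Rightarrow> 'a"
  assumes bil: "bilinear m"
begin

lemmas distribs [simp] =
  bilinear_ladd[OF bil] bilinear_radd[OF bil] bilinear_lsub[OF bil] bilinear_rsub[OF bil]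
  bilinear_lmul[OF bil] bilinear_rmul[OF bil] bilinear_lneg[OF bil] bilinear_rneg[OF bil]
  bilinear_lzero[OF bil] bilinear_rzero[OF bil]

end

text \<open>As the constant term is absent, the samples t = 1, -1, 2, -2 determine the four
  coefficients. This splits an identity for \<open>e + t y\<close> into its homogeneous parts in
  y.\<close>

lemma quartic_coeffs_zero:
  fixes p q r s :: "'a::real_vector"
  assumes "\<And>t::real. t *\<^sub>R p + t^2 *\<^sub>R q + t^3 *\<^sub>R r + t^4 *\<^sub>R s = 0"
  shows "p = 0" "q = 0" "r = 0" "s = 0"
proof -
  have a: "p + q + r + s = 0" using assms[of 1] by simp
  have b: "- p + q - r + s = 0" using assms[of "-1"] by simp
  have c: "2 *\<^sub>R p + 4 *\<^sub>R q + 8 *\<^sub>R r + 16 *\<^sub>R s = 0" using assms[of 2] by simp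
  have d: "- (2 *\<^sub>R p) + 4 *\<^sub>R q - 8 *\<^sub>R r + 16 *\<^sub>R s = 0" using assms[of "-2"] by simp
  have "6 *\<^sub>R r = (1/2) *\<^sub>R (2 *\<^sub>R p + 4 *\<^sub>R q + 8 *\<^sub>R r + 16 *\<^sub>R s)
      - (1/2) *\<^sub>R (- (2 *\<^sub>R p) + 4 *\<^sub>R q - 8 *\<^sub>R r + 16 *\<^sub>R s)
      - (p + q + r + s) + (- p + q - r + s)"
    by (rule eq_by_functionals) (simp (no_asm_simp) add: field_simps)
  then have "6 *\<^sub>R r = 0" unfolding a b c d by simp
  then show r: "r = 0" by simp
  have "24 *\<^sub>R s = (2 *\<^sub>R p + 4 *\<^sub>R q + 8 *\<^sub>R r + 16 *\<^sub>R s)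
      + (- (2 *\<^sub>R p) + 4 *\<^sub>R q - 8 *\<^sub>R r + 16 *\<^sub>R s)
      - 4 *\<^sub>R (p + q + r + s) - 4 *\<^sub>R (- p + q - r + s)"
    by (rule eq_by_functionals) (simp (no_asm_simp))
  then have "24 *\<^sub>R s = 0" unfolding a b c d by simp
  then show s: "s = 0" by simp
  have "2 *\<^sub>R p = (p + q + r + s) - (- p + q - r + s)" using r by (simp add: scaleR_2)
  then have "2 *\<^sub>R p = 0" unfolding a b by simp
  then show p: "p = 0" by simp
  show q: "q = 0" using a p r s by simp
qed

locale commutative_bilinear = real_bilinear +
  assumes comm: "m a b = m b a"
begin

text \<open>A Peirce decomposition obtained by expanding fourth-power associativity at
  \<open>e + t y\<close>. The coefficient of t leaves the eigenvalues 0, 1/2, 1 for multiplication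
  by e; injectivity discards 0, and the coefficients of t^2 and t^3 discard 1/2.\<close>

lemma idempotent_is_unit:
  assumes four: "\<And>x. m (m x x) (m x x) = m x (m x (m x x))"
    and nzd: "\<forall>a b. m a b = 0 \<longrightarrow> a = 0 \<or> b = 0"
    and e: "m e e = e" "e \<noteq> 0"
  shows "m e y = y"
proof -
  have coeffs: "4 *\<^sub>R m e (m e y) - 2 *\<^sub>R m e (m e (m e y)) - m e (m e y) - m e y = 0"
    (is "?p y = 0")
    "2 *\<^sub>R m e (m y y) + 4 *\<^sub>R m (m e y) (m e y) - m e (m e (m y y))
      - 2 *\<^sub>R m e (m y (m e y)) - 2 *\<^sub>R m y (m e (m e y)) - m y (m e y) = 0" (is "?q y = 0")
    "4 *\<^sub>R m (m e y) (m y y) - m e (m y (m y y)) - m y (m e (m y y)) - 2 *\<^sub>R m y (m y (m e y)) = 0"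
    (is "?r y = 0")
    for y
  proof -
    let ?s = "m (m y y) (m y y) - m y (m y (m y y))"
    have main: "t *\<^sub>R ?p y + t^2 *\<^sub>R ?q y + t^3 *\<^sub>R ?r y + t^4 *\<^sub>R ?s = 0" for t :: real
    proof -
      let ?x = "e + t *\<^sub>R y"
      have c: "m y e = m e y" "m (m e y) e = m e (m e y)" "m (m y y) e = m e (m y y)"
        "m (m e y) y = m y (m e y)" "m (m y y) (m e y) = m (m e y) (m y y)"
        by (simp_all add: comm)
      have sq: "m ?x ?x = e + (2*t) *\<^sub>R m e y + t^2 *\<^sub>R m y y"
        by (rule eq_by_functionals) (simp (no_asm_simp) add: c e algebra_simps power2_eq_square)
      have "m (m ?x ?x) (m ?x ?x) - m ?x (m ?x (m ?x ?x)) =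
        t *\<^sub>R ?p y + t^2 *\<^sub>R ?q y + t^3 *\<^sub>R ?r y + t^4 *\<^sub>R ?s"
        unfolding sq
        by (rule eq_by_functionals)
          (simp (no_asm_simp) add: c e algebra_simps power2_eq_square power3_eq_cube power4_eq_xxxx)
      with four[of ?x] show ?thesis by (simp only: diff_self)
    qed
    show "?p y = 0" "?q y = 0" "?r y = 0" using quartic_coeffs_zero[OF main] by auto
  qed
  \<comment> \<open>With L = \<open>m e\<close> the first coefficient is -L (2L - 1)(L - 1), so z =
    (L - 1) y is annihilated by 2L - 1.\<close>
  define z where "z = m e y - y"
  have "m e (2 *\<^sub>R m e z - z) = 0"
  proof -
    have "m e (2 *\<^sub>R m e z - z) = - (4 *\<^sub>R m e (m e y) - 2 *\<^sub>R m e (m e (m e y)) - m e (m e y) - m e y)"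
      by (rule eq_by_functionals) (simp (no_asm_simp) add: z_def)
    then show ?thesis using coeffs(1)[of y] by simp
  qed
  from nzd[rule_format, OF this] have "2 *\<^sub>R m e z = z" using e by auto
  then have h: "m e z = (1/2) *\<^sub>R z"
    by (metis scaleR_half_double scaleR_2 scaleR_scaleR scaleR_one nonzero_eq_divide_eq zero_neq_numeral)
  have "m e (m e (m z z) - m z z) = 0"
  proof -
    have "m e (m e (m z z) - m z z) = - (2 *\<^sub>R m e (m z z) + 4 *\<^sub>R m (m e z) (m e z)
      - m e (m e (m z z)) - 2 *\<^sub>R m e (m z (m e z)) - 2 *\<^sub>R m z (m e (m e z)) - m z (m e z))"
      by (rule eq_by_functionals) (simp (no_asm_simp) add: h)
    then show ?thesis using coeffs(2)[of z] by simp
  qed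
  from nzd[rule_format, OF this] have h2: "m e (m z z) = m z z" using e by auto
  \<comment> \<open>L halves z and fixes z^2, so the cubic coefficient collapses to -e z^3.\<close>
  have "m e (m z (m z z)) = 0"
  proof -
    have "m e (m z (m z z)) = - (4 *\<^sub>R m (m e z) (m z z) - m e (m z (m z z))
      - m z (m e (m z z)) - 2 *\<^sub>R m z (m z (m e z)))"
      by (rule eq_by_functionals) (simp (no_asm_simp) add: h h2)
    then show ?thesis using coeffs(3)[of z] by simp
  qed
  then have "z = 0" using nzd e by blast
  then show ?thesis by (simp add: z_def)
qed

end

section \<open>Quadratic algebras and natural norms\<close>

context commutative_bilinear
begin

lemma quadratic_dichotomy:
  assumes unit: "\<And>x. m e x = x" and "e \<noteq> 0"
    and nzd: "\<forall>a b. m a b = 0 \<longrightarrow> a = 0 \<or> b = 0"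
    and quad: "\<And>x. \<exists>a b. m x x = a *\<^sub>R x + b *\<^sub>R e"
  shows "(\<forall>x. \<exists>t. x = t *\<^sub>R e) \<or>
    (\<exists>u. m u u = - e \<and> (\<forall>x. \<exists>s t. x = s *\<^sub>R e + t *\<^sub>R u))"
proof -
  have unit': "m x e = x" for x using unit comm by metis
  have diff_squares: "m (x - y) (x + y) = m x x - m y y" for x y
    by (simp add: comm)
  have normal: "\<exists>s t u. x = s *\<^sub>R e + t *\<^sub>R u \<and> m u u = - e" if x: "\<nexists>t. x = t *\<^sub>R e" for x
  proof -
    obtain a b where ab: "m x x = a *\<^sub>R x + b *\<^sub>R e" using quad by blast
    define y where "y = x - (a/2) *\<^sub>R e"
    define c where "c = b + a^2/4"
    \<comment> \<open>Completing the square: 4 c is the discriminant, and c \<ge> 0 would split y^2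
      - c e into two real factors.\<close>
    have yy: "m y y = c *\<^sub>R e"
      by (rule eq_by_functionals)
        (simp (no_asm_simp) add: y_def c_def ab unit unit' field_simps power2_eq_square)
    have "c < 0"
    proof (rule ccontr)
      assume "\<not> c < 0"
      then have "m (y - sqrt c *\<^sub>R e) (y + sqrt c *\<^sub>R e) = 0"
        unfolding diff_squares by (simp add: yy unit unit')
      from nzd[rule_format, OF this] have "y = sqrt c *\<^sub>R e \<or> y = - sqrt c *\<^sub>R e"
        by (simp add: eq_neg_iff_add_eq_0)
      then have "x = (a/2 + sqrt c) *\<^sub>R e \<or> x = (a/2 - sqrt c) *\<^sub>R e"
        by (auto simp: y_def algebra_simps)
      with x show False by blast
    qed
    define r where "r = sqrt (- c)"
    have r: "r > 0" "r * r = - c" using \<open>c < 0\<close> by (simp_all add: r_def)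
    define u where "u = (1/r) *\<^sub>R y"
    have "c = - (r * r)" using r by simp
    then have "(1/r) * (1/r) * c = -1" using r(1) by simp
    then have "m u u = - e" unfolding u_def by (simp add: yy)
    moreover have "x = (a/2) *\<^sub>R e + r *\<^sub>R u" using r by (simp add: u_def y_def)
    ultimately show ?thesis by blast
  qed
  show ?thesis
  proof (cases "\<forall>x. \<exists>t. x = t *\<^sub>R e")
    case False
    then obtain u where u: "m u u = - e" using normal by blast
    have "\<exists>s t. x = s *\<^sub>R e + t *\<^sub>R u" for x
    proof (cases "\<exists>t. x = t *\<^sub>R e")
      case True
      then obtain t where "x = t *\<^sub>R e + 0 *\<^sub>R u" by auto
      then show ?thesis by blast
    next
      case False
      then obtain s t v where v: "x = s *\<^sub>R e + t *\<^sub>R v" "m v v = - e" using normal by blast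
      have "m (u - v) (u + v) = 0" unfolding diff_squares by (simp add: u v)
      from nzd[rule_format, OF this] have "v = u \<or> v = - u"
        by (auto simp: eq_neg_iff_add_eq_0 add.commute)
      then have "x = s *\<^sub>R e + t *\<^sub>R u \<or> x = s *\<^sub>R e + (- t) *\<^sub>R u" using v by auto
      then show ?thesis by blast
    qed
    with u show ?thesis by blast
  qed blast
qed

lemma isomorphic_to_R_or_C:
  assumes unit: "\<And>x. m e x = x" and "e \<noteq> 0"
    and nzd: "\<forall>a b. m a b = 0 \<longrightarrow> a = 0 \<or> b = 0"
    and quad: "\<And>x. \<exists>a b. m x x = a *\<^sub>R x + b *\<^sub>R e"
  shows "(\<exists>\<phi> :: 'a \<Rightarrow> real. linear \<phi> \<and> bij \<phi> \<and> (\<forall>a b. \<phi> (m a b) = \<phi> a * \<phi> b)) \<or>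
    (\<exists>\<phi> :: 'a \<Rightarrow> complex. linear \<phi> \<and> bij \<phi> \<and> (\<forall>a b. \<phi> (m a b) = \<phi> a * \<phi> b))"
proof -
  have unit': "m x e = x" for x using unit comm by metis
  from quadratic_dichotomy[OF assms] show ?thesis
  proof (elim disjE exE conjE)
    assume "\<forall>x. \<exists>t. x = t *\<^sub>R e"
    then obtain f where f: "\<And>x. x = f x *\<^sub>R e" by metis
    have val: "f (t *\<^sub>R e) = t" for t
      using f[of "t *\<^sub>R e"] \<open>e \<noteq> 0\<close> by simp
    have "f (x + y) = f x + f y" for x y
      using val[of "f x + f y"] f[of x] f[of y] by (simp add: scaleR_add_left)
    moreover have "f (c *\<^sub>R x) = c * f x" for c x
      using val[of "c * f x"] f[of x] by (metis scaleR_scaleR)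
    moreover have "f (m x y) = f x * f y" for x y
    proof -
      have "m x y = m (f x *\<^sub>R e) (f y *\<^sub>R e)" using f by metis
      then show ?thesis by (simp add: unit val)
    qed
    moreover have "bij f"
      by (rule bij_betw_byWitness[where f' = "\<lambda>t. t *\<^sub>R e"]) (use f val in auto)
    ultimately have "linear f \<and> bij f \<and> (\<forall>a b. f (m a b) = f a * f b)"
      by (auto intro!: linearI)
    then show ?thesis by blast
  next
    fix u assume u: "m u u = - e" and "\<forall>x. \<exists>s t. x = s *\<^sub>R e + t *\<^sub>R u"
    then obtain f g where fg: "\<And>x. x = f x *\<^sub>R e + g x *\<^sub>R u" by metis
    have indep: "s = 0 \<and> t = 0" if "s *\<^sub>R e + t *\<^sub>R u = 0" for s t
    proof -
      \<comment> \<open>The product with the conjugate is a sum of two squares times e.\<close>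
      have "(s * s + t * t) *\<^sub>R e = m (s *\<^sub>R e + t *\<^sub>R u) (s *\<^sub>R e - t *\<^sub>R u)"
        by (rule eq_by_functionals) (simp (no_asm_simp) add: u unit unit' algebra_simps)
      then have "s * s + t * t = 0" using that \<open>e \<noteq> 0\<close> by simp
      then show ?thesis by (simp add: sum_squares_eq_zero_iff)
    qed
    have val: "f (s *\<^sub>R e + t *\<^sub>R u) = s \<and> g (s *\<^sub>R e + t *\<^sub>R u) = t" for s t
    proof -
      let ?x = "s *\<^sub>R e + t *\<^sub>R u"
      have "(f ?x - s) *\<^sub>R e + (g ?x - t) *\<^sub>R u = 0"
        using fg[of ?x] by (simp add: algebra_simps)
      then show ?thesis using indep by fastforce
    qed
    have valI: "f x = s \<and> g x = t" if "x = s *\<^sub>R e + t *\<^sub>R u" for x s t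
      using val that by simp
    define \<phi> where "\<phi> x = Complex (f x) (g x)" for x
    have "x + y = (f x + f y) *\<^sub>R e + (g x + g y) *\<^sub>R u" for x y
      by (subst fg[of x], subst fg[of y]) (simp add: algebra_simps)
    from valI[OF this] have "\<phi> (x + y) = \<phi> x + \<phi> y" for x y
      by (simp add: \<phi>_def complex_eq_iff)
    moreover have "c *\<^sub>R x = (c * f x) *\<^sub>R e + (c * g x) *\<^sub>R u" for c x
      by (subst fg[of x]) (simp add: algebra_simps)
    from valI[OF this] have "\<phi> (c *\<^sub>R x) = c *\<^sub>R \<phi> x" for c x
      by (simp add: \<phi>_def complex_eq_iff)
    moreover have "m x y = (f x * f y - g x * g y) *\<^sub>R e + (f x * g y + g x * f y) *\<^sub>R u" for x y
    proof -
      have "m x y = m (f x *\<^sub>R e + g x *\<^sub>R u) (f y *\<^sub>R e + g y *\<^sub>R u)" using fg by metis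
      then show ?thesis by (simp add: u unit unit' algebra_simps)
    qed
    from valI[OF this] have "\<phi> (m x y) = \<phi> x * \<phi> y" for x y
      by (simp add: \<phi>_def complex_eq_iff)
    moreover have "bij \<phi>"
      by (rule bij_betw_byWitness[where f' = "\<lambda>z. Re z *\<^sub>R e + Im z *\<^sub>R u"])
        (use fg[symmetric] val in \<open>auto simp: \<phi>_def\<close>)
    ultimately have "linear \<phi> \<and> bij \<phi> \<and> (\<forall>a b. \<phi> (m a b) = \<phi> a * \<phi> b)"
      by (auto intro!: linearI)
    then show ?thesis by blast
  qed
qed

end

section \<open>Uniqueness of the natural norm and transport of structure\<close>

lemma vs_normD:
  assumes "vs_norm N"
  shows "0 \<le> N x" "N x = 0 \<longleftrightarrow> x = 0" "N (x + y) \<le> N x + N y" "N (c *\<^sub>R x) = \<bar>c\<bar> * N x"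
  using assms by (auto simp: vs_norm_def)

lemma inner_power_norm_real:
  fixes N :: "real \<Rightarrow> real"
  assumes "inner_power_norm (*) N"
  shows "N = norm"
proof
  fix x
  have N: "vs_norm N" and "N (((*) 1 ^^ 1) 1) = N 1 ^ Suc 1"
    using assms unfolding inner_power_norm_def by blast+
  then have "N 1 = 1" using vs_normD(2)[OF N, of 1] by (simp add: power2_eq_square)
  then show "N x = norm x" using vs_normD(4)[OF N, of x 1] by simp
qed

text \<open>Squares alone fix the Gram matrix of 1 and i: both get norm 1, and (1 + i)^2 = 2 i
  forces their inner product to vanish.\<close>

lemma inner_power_norm_complex:
  fixes N :: "complex \<Rightarrow> real"
  assumes "inner_power_norm (*) N"
  shows "N = norm"
proof
  fix z
  obtain B where N: "vs_norm N" and B: "bilinear B" "\<And>x y. B x y = B y x"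
    and NB: "N = inner_product_norm B" and pow: "\<And>x k. N (((*) x ^^ k) x) = N x ^ Suc k"
    using assms unfolding inner_power_norm_def real_inner_product_def by blast
  note B_simps = bilinear_ladd[OF B(1)] bilinear_radd[OF B(1)] bilinear_lmul[OF B(1)] bilinear_rmul[OF B(1)]
  have sq: "N (x * x) = (N x)\<^sup>2" for x using pow[of 1 x] by (simp add: power2_eq_square)
  have "N 1 = 1" using sq[of 1] vs_normD(2)[OF N, of 1] by (simp add: power2_eq_square)
  have "N (- 1) = 1" using vs_normD(4)[OF N, of "-1" 1] \<open>N 1 = 1\<close> by simp
  then have "(N \<i>)\<^sup>2 = 1" using sq[of \<i>] by simp
  have "0 \<le> B x x" for x using vs_normD(1)[OF N, of x] by (simp add: NB inner_product_norm_def)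
  then have BN: "B x x = (N x)\<^sup>2" for x by (simp add: NB inner_product_norm_def)
  have B1: "B 1 1 = 1" and Bi: "B \<i> \<i> = 1"
    using \<open>N 1 = 1\<close> \<open>(N \<i>)\<^sup>2 = 1\<close> by (simp_all add: BN)
  have "N ((1 + \<i>) * (1 + \<i>)) = 2"
  proof -
    have "(1 + \<i>) * (1 + \<i>) = 2 *\<^sub>R \<i>" by (simp add: complex_eq_iff)
    moreover have "N \<i> = 1" using \<open>(N \<i>)\<^sup>2 = 1\<close> vs_normD(1)[OF N] by (simp add: power2_eq_1_iff) (smt (verit))
    ultimately show ?thesis by (simp only: vs_normD(4)[OF N])
  qed
  then have "B (1 + \<i>) (1 + \<i>) = 2" using sq BN by metis
  then have B1i: "B 1 \<i> = 0" "B \<i> 1 = 0" using B1 Bi B(2)[of 1 \<i>] by (auto simp: B_simps)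
  define s t where "s = Re z" and "t = Im z"
  have z: "z = s *\<^sub>R 1 + t *\<^sub>R \<i>" by (simp add: complex_eq_iff s_def t_def)
  have "(N z)\<^sup>2 = B z z" by (simp add: BN)
  also have "\<dots> = (Re z)\<^sup>2 + (Im z)\<^sup>2"
    unfolding s_def[symmetric] t_def[symmetric] unfolding z
    by (simp only: B_simps B1 Bi B1i) (simp add: power2_eq_square)
  finally show "N z = norm z"
    by (metis cmod_power2 norm_ge_zero power2_eq_imp_eq vs_normD(1)[OF N])
qed

text \<open>A general codomain lets the reals and the complex numbers share the argument. The
  hypothesis on inverses closes every unital subalgebra under inversion, the spanning pair bounds
  dimensions by two, and uniqueness of the norm is pulled back along the isomorphism.\<close>

lemma natural_structure:
  fixes m :: "'a::real_vector \<Rightarrow> 'a \<Rightarrow> 'a"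
    and \<phi> :: "'a \<Rightarrow> 'b::{real_normed_field, real_inner}"
  assumes \<phi>: "linear \<phi>" "bij \<phi>" "\<And>a b. \<phi> (m a b) = \<phi> a * \<phi> b"
    and unique: "\<And>N :: 'b \<Rightarrow> real. inner_power_norm (*) N \<Longrightarrow> N = norm"
    and inverse: "\<And>z::'b. \<exists>s t. inverse z = s *\<^sub>R 1 + t *\<^sub>R z"
    and spanning: "\<exists>u::'b. \<forall>z. \<exists>s t. z = s *\<^sub>R 1 + t *\<^sub>R u"
  shows "locally_complex m" "is_natural_norm m (\<lambda>x. norm (\<phi> x))"
proof -
  define \<psi> where "\<psi> = inv_into UNIV \<phi>"
  have [simp]: "\<phi> (\<psi> z) = z" "\<psi> (\<phi> x) = x" for z x
    using \<phi>(2) by (auto simp: \<psi>_def bij_is_surj surj_f_inv_f bij_is_inj)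
  have inj: "x = y" if "\<phi> x = \<phi> y" for x y using that \<phi>(2) by (metis bij_pointE)
  have hom: "\<phi> (x + y) = \<phi> x + \<phi> y" "\<phi> (c *\<^sub>R x) = c *\<^sub>R \<phi> x" "\<phi> 0 = 0" "\<phi> (- x) = - \<phi> x"
    for x y c using \<phi>(1) by (simp_all add: linear_add linear_scale linear_0 linear_neg)
  have \<psi>hom: "\<psi> (x + y) = \<psi> x + \<psi> y" "\<psi> (c *\<^sub>R x) = c *\<^sub>R \<psi> x" "\<psi> (x * y) = m (\<psi> x) (\<psi> y)"
    for x y c by (rule inj, simp add: hom \<phi>(3))+
  define e where "e = \<psi> 1"
  have unit: "alg_unit m e" unfolding alg_unit_def e_def
    by (auto intro!: inj simp: \<phi>(3))
  obtain u :: 'b where u: "\<And>z. \<exists>s t. z = s *\<^sub>R 1 + t *\<^sub>R u" using spanning by blast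
  have span: "span {e, \<psi> u} = UNIV"
  proof -
    have "x \<in> span {e, \<psi> u}" for x
    proof -
      obtain s t where st: "\<phi> x = s *\<^sub>R 1 + t *\<^sub>R u" using u by blast
      have "x = s *\<^sub>R e + t *\<^sub>R \<psi> u" by (rule inj) (simp add: hom st e_def)
      then show ?thesis by (simp add: span_add span_scale span_base)
    qed
    then show ?thesis by blast
  qed
  have quad: "quadratic_algebra m"
    unfolding quadratic_algebra_def
  proof (intro exI conjI allI)
    show "alg_unit m e" by fact
    show "finite {e, \<psi> u}" by simp
    show "card {e, \<psi> u} \<le> 2" by (simp add: card_insert_if)
  qed (simp add: span)
  have "field (subalgebra_ring m e (alg_generated m {e, x}))" for x
  proof -
    define S where "S = alg_generated m {e, x}"
    have sub: "is_subalgebra m S"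
      unfolding S_def alg_generated_def
      by (rule hull_in) (auto simp: is_subalgebra_def intro: subspace_Inter)
    then have S: "subspace S" "\<And>x y. x \<in> S \<Longrightarrow> y \<in> S \<Longrightarrow> m x y \<in> S"
      by (auto simp: is_subalgebra_def)
    have "e \<in> S" unfolding S_def alg_generated_def by (rule hull_inc) simp
    have inv_in: "\<psi> (inverse (\<phi> y)) \<in> S" if "y \<in> S" for y
    proof -
      obtain s t where st: "inverse (\<phi> y) = s *\<^sub>R 1 + t *\<^sub>R \<phi> y" using inverse by blast
      have "\<psi> (inverse (\<phi> y)) = s *\<^sub>R e + t *\<^sub>R y" by (simp add: st \<psi>hom e_def)
      then show ?thesis using S(1) \<open>e \<in> S\<close> that by (simp add: subspace_add subspace_scale)
    qed
    define R where "R = subalgebra_ring m e S"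
    have [simp]: "carrier R = S" "x \<otimes>\<^bsub>R\<^esub> y = m x y" "\<one>\<^bsub>R\<^esub> = e" "\<zero>\<^bsub>R\<^esub> = 0" "x \<oplus>\<^bsub>R\<^esub> y = x + y" for x y
      by (simp_all add: subalgebra_ring_def R_def)
    have "cring R"
    proof (rule cringI)
      show "abelian_group R"
      proof (rule abelian_groupI)
        fix x assume "x \<in> carrier R"
        then have "- x \<in> S" "- x + x = 0" using S(1) by (auto simp: subspace_neg)
        then show "\<exists>y\<in>carrier R. y \<oplus>\<^bsub>R\<^esub> x = \<zero>\<^bsub>R\<^esub>" by (auto intro!: bexI[of _ "- x"])
      qed (use S(1) in \<open>auto simp: subspace_add subspace_0 add_ac\<close>)
      show "Group.comm_monoid R"
        by (rule comm_monoidI)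
          (use S \<open>e \<in> S\<close> in \<open>auto intro!: inj simp: \<phi>(3) e_def mult_ac\<close>)
    qed (auto intro!: inj simp: hom \<phi>(3) distrib_right)
    then have "field R"
    proof (rule cring.cring_fieldI2)
      show "\<zero>\<^bsub>R\<^esub> \<noteq> \<one>\<^bsub>R\<^esub>"
        by (simp add: e_def) (metis \<open>\<And>z. \<phi> (\<psi> z) = z\<close> hom(3) zero_neq_one)
      fix a assume "a \<in> carrier R" "a \<noteq> \<zero>\<^bsub>R\<^esub>"
      then have "a \<in> S" "\<phi> a \<noteq> 0" using inj[of a 0] hom(3) by auto
      then have "m a (\<psi> (inverse (\<phi> a))) = e" by (intro inj) (simp add: \<phi>(3) e_def)
      then show "\<exists>b\<in>carrier R. a \<otimes>\<^bsub>R\<^esub> b = \<one>\<^bsub>R\<^esub>"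
        using inv_in[OF \<open>a \<in> S\<close>] by auto
    qed
    then show ?thesis by (simp add: S_def R_def)
  qed
  with quad unit show "locally_complex m" unfolding locally_complex_def by blast
  have \<phi>pow: "\<phi> ((m x ^^ k) y) = \<phi> x ^ k * \<phi> y" for x y k
    by (induction k) (simp_all add: \<phi>(3) mult_ac)
  have bpow: "((*) x ^^ k) y = x ^ k * y" for x y :: 'b and k
    by (induction k) (simp_all add: mult_ac)
  let ?N = "\<lambda>x. norm (\<phi> x)"
  have "inner_power_norm m ?N"
    unfolding inner_power_norm_def
  proof (intro conjI allI)
    show "vs_norm ?N"
      using inj[of _ 0] by (auto simp: vs_norm_def hom norm_triangle_ineq)
    let ?B = "\<lambda>x y. inner (\<phi> x) (\<phi> y)"
    have "bilinear ?B"
      by (auto simp: bilinear_def hom inner_add_left inner_add_right intro!: linearI)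
    then have "real_inner_product ?B"
      unfolding real_inner_product_def using inj[of _ 0] by (auto simp: hom inner_commute)
    moreover have "?N = inner_product_norm ?B"
      by (auto simp: inner_product_norm_def norm_eq_sqrt_inner)
    ultimately show "\<exists>B. real_inner_product B \<and> ?N = inner_product_norm B" by blast
    show "norm (\<phi> ((m x ^^ k) x)) = norm (\<phi> x) ^ Suc k" for x k
      by (simp add: \<phi>pow norm_mult norm_power)
  qed
  moreover have "N = ?N" if N: "inner_power_norm m N" for N
  proof -
    obtain B where "vs_norm N" and B: "real_inner_product B" "N = inner_product_norm B"
      and pow: "\<And>x k. N ((m x ^^ k) x) = N x ^ Suc k"
      using N unfolding inner_power_norm_def by blast
    let ?M = "\<lambda>z. N (\<psi> z)"
    have \<psi>0: "\<psi> z = 0 \<longleftrightarrow> z = 0" for z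
      by (metis \<open>\<And>z. \<phi> (\<psi> z) = z\<close> \<open>\<And>x. \<psi> (\<phi> x) = x\<close> hom(3))
    have "inner_power_norm (*) ?M"
      unfolding inner_power_norm_def
    proof (intro conjI allI)
      show "vs_norm ?M"
        using \<open>vs_norm N\<close> by (auto simp: vs_norm_def \<psi>hom \<psi>0)
      let ?C = "\<lambda>x y. B (\<psi> x) (\<psi> y)"
      have b: "bilinear B" using B(1) by (simp add: real_inner_product_def)
      have "bilinear ?C"
        by (auto simp: bilinear_def \<psi>hom bilinear_ladd[OF b] bilinear_radd[OF b]
            bilinear_lmul[OF b] bilinear_rmul[OF b] intro!: linearI)
      then have "real_inner_product ?C"
        using B(1) unfolding real_inner_product_def by (auto simp: \<psi>0)
      moreover have "?M = inner_product_norm ?C"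
        by (auto simp: inner_product_norm_def B(2))
      ultimately show "\<exists>B. real_inner_product B \<and> ?M = inner_product_norm B" by blast
      show "?M (((*) z ^^ k) z) = ?M z ^ Suc k" for z k
      proof -
        have "\<psi> (((*) z ^^ k) z) = (m (\<psi> z) ^^ k) (\<psi> z)"
          by (rule inj) (simp add: \<phi>pow bpow)
        then show ?thesis by (simp add: pow)
      qed
    qed
    then have "?M = norm" by (rule unique)
    then show ?thesis by (metis \<open>\<And>x. \<psi> (\<phi> x) = x\<close>)
  qed
  ultimately show "is_natural_norm m ?N" unfolding is_natural_norm_def by blast
qed

lemma natural_structure_real:
  fixes \<phi> :: "'a::real_vector \<Rightarrow> real"
  assumes "linear \<phi>" "bij \<phi>" "\<And>a b. \<phi> (m a b) = \<phi> a * \<phi> b"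
  shows "locally_complex m" "is_natural_norm m (\<lambda>x. norm (\<phi> x))"
proof -
  have "\<exists>s t. inverse z = s *\<^sub>R 1 + t *\<^sub>R z" for z :: real
    by (intro exI[of _ "inverse z"] exI[of _ 0]) simp
  note inv = this
  have sp: "\<exists>u::real. \<forall>z. \<exists>s t. z = s *\<^sub>R 1 + t *\<^sub>R u"
    by (rule exI[of _ 1], rule allI, rule_tac x = z in exI, rule_tac x = 0 in exI) simp
  show "locally_complex m" "is_natural_norm m (\<lambda>x. norm (\<phi> x))"
    by (rule natural_structure[of \<phi> m, OF assms _ inv sp], erule inner_power_norm_real)+
qed

lemma natural_structure_complex:
  fixes \<phi> :: "'a::real_vector \<Rightarrow> complex"
  assumes "linear \<phi>" "bij \<phi>" "\<And>a b. \<phi> (m a b) = \<phi> a * \<phi> b"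
  shows "locally_complex m" "is_natural_norm m (\<lambda>x. norm (\<phi> x))"
proof -
  \<comment> \<open>The identity cnj z = 2 Re z - z removes the conjugate; for z = 0 both sides are
    0 because division by zero gives 0.\<close>
  have "inverse z = (2 * Re z / (cmod z)\<^sup>2) *\<^sub>R 1 + (- 1 / (cmod z)\<^sup>2) *\<^sub>R z" for z
    by (simp add: complex_eq_iff cmod_power2 diff_divide_distrib[symmetric])
  then have "\<exists>s t. inverse z = s *\<^sub>R 1 + t *\<^sub>R z" for z :: complex by blast
  note inv = this
  have sp: "\<exists>u::complex. \<forall>z. \<exists>s t. z = s *\<^sub>R 1 + t *\<^sub>R u"
    by (rule exI[of _ \<i>], rule allI, rule_tac x = "Re z" in exI, rule_tac x = "Im z" in exI)
      (simp add: complex_eq_iff)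
  show "locally_complex m" "is_natural_norm m (\<lambda>x. norm (\<phi> x))"
    by (rule natural_structure[of \<phi> m, OF assms _ inv sp], erule inner_power_norm_complex)+
qed

lemma naturally_R_or_C_if_isomorphic:
  fixes m :: "'a::real_vector \<Rightarrow> 'a \<Rightarrow> 'a"
  assumes "(\<exists>\<phi> :: 'a \<Rightarrow> real. linear \<phi> \<and> bij \<phi> \<and> (\<forall>a b. \<phi> (m a b) = \<phi> a * \<phi> b)) \<or>
    (\<exists>\<phi> :: 'a \<Rightarrow> complex. linear \<phi> \<and> bij \<phi> \<and> (\<forall>a b. \<phi> (m a b) = \<phi> a * \<phi> b))"
  shows "naturally_R_or_C m"
  using assms
proof (elim disjE exE conjE)
  fix \<phi> :: "'a \<Rightarrow> real"
  assume \<phi>: "linear \<phi>" "bij \<phi>" "\<forall>a b. \<phi> (m a b) = \<phi> a * \<phi> b"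
  have "isometric_isomorphism m (\<lambda>x. norm (\<phi> x)) \<phi>" using \<phi> by (simp add: isometric_isomorphism_def)
  moreover have "locally_complex m" "is_natural_norm m (\<lambda>x. norm (\<phi> x))"
    by (rule natural_structure_real[of \<phi> m]; use \<phi> in simp)+
  ultimately show ?thesis unfolding naturally_R_or_C_def isometric_to_R_or_C_def by blast
next
  fix \<phi> :: "'a \<Rightarrow> complex"
  assume \<phi>: "linear \<phi>" "bij \<phi>" "\<forall>a b. \<phi> (m a b) = \<phi> a * \<phi> b"
  have "isometric_isomorphism m (\<lambda>x. norm (\<phi> x)) \<phi>" using \<phi> by (simp add: isometric_isomorphism_def)
  moreover have "locally_complex m" "is_natural_norm m (\<lambda>x. norm (\<phi> x))"
    by (rule natural_structure_complex[of \<phi> m]; use \<phi> in simp)+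
  ultimately show ?thesis unfolding naturally_R_or_C_def isometric_to_R_or_C_def by blast
qed

section \<open>Algebras with a cubic relation\<close>

lemma subalgebra_alg_generated: "is_subalgebra m (alg_generated m X)"
  unfolding alg_generated_def
  by (rule hull_in) (auto simp: is_subalgebra_def intro: subspace_Inter)

lemma alg_generated_base: "x \<in> X \<Longrightarrow> x \<in> alg_generated m X"
  unfolding alg_generated_def by (rule hull_inc)

lemma alg_generated_mult: "x \<in> alg_generated m X \<Longrightarrow> y \<in> alg_generated m X \<Longrightarrow> m x y \<in> alg_generated m X"
  and subspace_alg_generated: "subspace (alg_generated m X)"
  using subalgebra_alg_generated[of m X] by (auto simp: is_subalgebra_def)

lemma power_associativeD:
  assumes "power_associative m" "x \<in> alg_generated m {a}" "y \<in> alg_generated m {a}" "z \<in> alg_generated m {a}"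
  shows "m (m x y) z = m x (m y z)"
  using assms unfolding power_associative_def by blast

context real_bilinear
begin

text \<open>Inside the associative algebra generated by a, the centralizer of an element is again a
  subalgebra. This is used twice: a commutes with itself, so everything commutes with a, so any two
  elements commute.\<close>

lemma alg_generated_singleton_commute:
  assumes pa: "power_associative m" and x: "x \<in> alg_generated m {a}" and y: "y \<in> alg_generated m {a}"
  shows "m x y = m y x"
proof -
  let ?S = "alg_generated m {a}"
  note assoc = power_associativeD[OF pa, of _ a]
  have centralizer: "is_subalgebra m {x \<in> ?S. m x y = m y x}" if y: "y \<in> ?S" for y
    unfolding is_subalgebra_def
  proof (intro conjI ballI)
    show "subspace {x \<in> ?S. m x y = m y x}"
      using subspace_alg_generated[of m "{a}"] by (auto simp: subspace_def)
    fix u v assume u: "u \<in> {x \<in> ?S. m x y = m y x}" and v: "v \<in> {x \<in> ?S. m x y = m y x}"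
    then have "m (m u v) y = m u (m y v)" using y by (simp add: assoc)
    also have "\<dots> = m (m y u) v" using u v y assoc[of u y v] by simp
    finally show "m u v \<in> {x \<in> ?S. m x y = m y x}"
      using u v y by (simp add: assoc alg_generated_mult)
  qed
  have sub: "?S \<subseteq> {x \<in> ?S. m x y = m y x}" if "y \<in> ?S" "m a y = m y a" for y
    unfolding alg_generated_def
    by (rule hull_minimal)
      (use that centralizer[OF that(1)] in \<open>auto simp: alg_generated_def intro: hull_inc\<close>)
  have "m a y = m y a" using sub[of a] y by (auto simp: alg_generated_base)
  then show ?thesis using sub[of y] x y by auto
qed

theorem naturally_R_or_C_if_cubic:
  assumes nontrivial: "\<exists>x::'a. x \<noteq> 0" and pa: "power_associative m"
    and nzd: "\<forall>a b. m a b + m b a = 0 \<longrightarrow> a = 0 \<or> b = 0"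
    and cubic: "\<And>x. \<exists>\<alpha> \<gamma>. \<alpha>\<^sup>2 \<le> \<gamma> \<and> m x (m x x) = (2 * \<alpha>) *\<^sub>R m x x - \<gamma> *\<^sub>R x"
  shows "naturally_R_or_C m"
proof -
  have x_in: "x \<in> alg_generated m {x}" for x by (simp add: alg_generated_base)
  have p3: "m (m x x) x = m x (m x x)" for x
    by (rule power_associativeD[OF pa, of _ x]) (simp_all add: x_in alg_generated_mult)
  have p4: "m (m x x) (m x x) = m x (m x (m x x))" for x
    by (rule power_associativeD[OF pa, of _ x]) (simp_all add: x_in alg_generated_mult)
  have p4': "m (m x (m x x)) x = m x (m x (m x x))" for x
    by (simp add: power_associativeD[OF pa, of _ x] x_in alg_generated_mult)
  define j where "j a b = (1/2) *\<^sub>R (m a b + m b a)" for a b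
  have j_self: "j x x = m x x" for x by (simp add: j_def scaleR_2[symmetric])
  interpret J: commutative_bilinear j
    by unfold_locales
      (auto simp: j_def bilinear_def algebra_simps intro!: linearI)
  have jnzd: "\<forall>a b. j a b = 0 \<longrightarrow> a = 0 \<or> b = 0" using nzd by (simp add: j_def)
  have jfour: "j (j x x) (j x x) = j x (j x (j x x))" for x
    by (simp add: j_self p4) (simp add: j_def p3 p4' scaleR_2[symmetric])
  have idem: "\<exists>e \<alpha> \<gamma>. m e e = e \<and> e \<noteq> 0 \<and> m e x = x \<and> m x e = x \<and> m x x = \<alpha> *\<^sub>R x + \<gamma> *\<^sub>R e"
    if "x \<noteq> 0" for x
  proof -
    obtain \<alpha> \<gamma> where c: "\<alpha>\<^sup>2 \<le> \<gamma>" "m x (m x x) = (2 * \<alpha>) *\<^sub>R m x x - \<gamma> *\<^sub>R x"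
      using cubic by blast
    have "\<gamma> \<noteq> 0"
    proof
      assume "\<gamma> = 0"
      with c have "m x (m x x) = 0" by simp
      then have "m x x = 0" using nzd[rule_format, of x "m x x"] p3[of x] that by simp
      then show False using nzd[rule_format, of x x] that by simp
    qed
    \<comment> \<open>Solved for x, the cubic relation reads x = e x for this e; as e also fixes
      x^2, it fixes itself.\<close>
    define e where "e = (1/\<gamma>) *\<^sub>R ((2 * \<alpha>) *\<^sub>R x - m x x)"
    have ex: "m e x = x" "m x e = x"
      using \<open>\<gamma> \<noteq> 0\<close> by (simp_all add: e_def p3 c(2) algebra_simps)
    have exx: "m e (m x x) = m x x"
    proof -
      have "m e (m x x) = (1/\<gamma>) *\<^sub>R m x ((2 * \<alpha>) *\<^sub>R m x x - m x (m x x))"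
        by (simp add: e_def p4)
      also have "(2 * \<alpha>) *\<^sub>R m x x - m x (m x x) = \<gamma> *\<^sub>R x" using c(2) by simp
      finally show ?thesis using \<open>\<gamma> \<noteq> 0\<close> by simp
    qed
    have "m e e = (1/\<gamma>) *\<^sub>R ((2 * \<alpha>) *\<^sub>R m e x - m e (m x x))"
      by (subst (2) e_def) simp
    then have "m e e = (1/\<gamma>) *\<^sub>R ((2 * \<alpha>) *\<^sub>R x - m x x)" by (simp only: ex exx)
    then have "m e e = e" by (simp only: e_def[symmetric])
    moreover have "e \<noteq> 0" using ex that by auto
    moreover have "m x x = (2 * \<alpha>) *\<^sub>R x + (- \<gamma>) *\<^sub>R e"
      using \<open>\<gamma> \<noteq> 0\<close> by (simp add: e_def)
    ultimately show ?thesis using ex by blast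
  qed
  obtain e where e: "m e e = e" "e \<noteq> 0" using nontrivial idem by metis
  have junit: "j f y = y" if "m f f = f" "f \<noteq> 0" for f y
    by (rule J.idempotent_is_unit[OF jfour jnzd]) (use that in \<open>simp_all add: j_self\<close>)
  \<comment> \<open>Every x \<noteq> 0 brings its own idempotent; as units of \<open>j\<close> they
    all coincide, so one e serves every x.\<close>
  have idem_unique: "f = e" if "m f f = f" "f \<noteq> 0" for f
    using junit[OF that, of e] junit[OF e, of f] J.comm by metis
  have unit: "m e x = x" "m x e = x" and quad: "\<exists>a b. m x x = a *\<^sub>R x + b *\<^sub>R e" for x
  proof -
    have "m e x = x \<and> m x e = x \<and> (\<exists>a b. m x x = a *\<^sub>R x + b *\<^sub>R e)"
    proof (cases "x = 0")
      case True
      then have "m x x = 0 *\<^sub>R x + 0 *\<^sub>R e" by simp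
      with True show ?thesis by (metis distribs(9,10))
    next
      case False
      then show ?thesis using idem idem_unique by metis
    qed
    then show "m e x = x" "m x e = x" "\<exists>a b. m x x = a *\<^sub>R x + b *\<^sub>R e" by auto
  qed
  have jquad: "\<exists>a b. j x x = a *\<^sub>R x + b *\<^sub>R e" for x using quad j_self by metis
  have "\<exists>u. \<forall>x. \<exists>s t. x = s *\<^sub>R e + t *\<^sub>R u"
    using J.quadratic_dichotomy[OF junit[OF e] e(2) jnzd jquad]
  proof (elim disjE exE conjE)
    assume "\<forall>x. \<exists>t. x = t *\<^sub>R e"
    then have "\<forall>x. \<exists>s t. x = s *\<^sub>R e + t *\<^sub>R e" by (metis add_0_right scaleR_zero_left)
    then show ?thesis by blast
  qed blast
  then obtain u where u: "\<And>x. \<exists>s t. x = s *\<^sub>R e + t *\<^sub>R u" by blast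
  \<comment> \<open>Commutativity of the original product emerges only here, because all elements
    are combinations of e and a single u.\<close>
  have "m x y = m y x" for x y
  proof -
    obtain s t where x: "x = s *\<^sub>R e + t *\<^sub>R u" using u by blast
    obtain p q where y: "y = p *\<^sub>R e + q *\<^sub>R u" using u by blast
    show ?thesis by (simp add: x y unit algebra_simps)
  qed
  then have "j = m" by (intro ext) (simp add: j_def scaleR_2[symmetric])
  then show ?thesis
    using naturally_R_or_C_if_isomorphic[OF J.isomorphic_to_R_or_C[OF junit[OF e] e(2) jnzd jquad]]
    by simp
qed

text \<open>The real (\<open>g = Re\<close>) or imaginary (\<open>g = Im\<close>) part of the value at \<open>a\<close> of \<open>t p(t)\<close>; the
  factor \<open>t\<close> avoids the need for a unit.\<close>

definition part_eval :: "'a \<Rightarrow> (complex \<Rightarrow> real) \<Rightarrow> complex poly \<Rightarrow> 'a" where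
  "part_eval a g p = (\<Sum>i\<le>degree p. g (coeff p i) *\<^sub>R (m a ^^ i) a)"

context
  fixes a :: 'a and g :: "complex \<Rightarrow> real"
  assumes g: "linear g"
begin

lemma part_eval_upto:
  assumes "degree p \<le> n"
  shows "part_eval a g p = (\<Sum>i\<le>n. g (coeff p i) *\<^sub>R (m a ^^ i) a)"
  unfolding part_eval_def
  by (rule sum.mono_neutral_left) (use assms g in \<open>auto simp: coeff_eq_0 linear_0\<close>)

lemma part_eval_add: "part_eval a g (p + q) = part_eval a g p + part_eval a g q"
proof -
  let ?n = "max (degree p) (degree q)"
  have "degree (p + q) \<le> ?n" by (rule degree_add_le_max)
  then show ?thesis
    by (simp add: part_eval_upto[of _ ?n] linear_add[OF g] scaleR_add_left sum.distrib)
qed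

lemma part_eval_smult: "part_eval a g (smult (of_real c) p) = c *\<^sub>R part_eval a g p"
proof -
  have "g (of_real c * z) = c * g z" for z
    using linear_scale[OF g, of c z] by (simp add: scaleR_conv_of_real)
  then show ?thesis
    by (simp add: part_eval_upto[of "smult (of_real c) p" "degree p"] part_eval_def scaleR_sum_right)
qed

lemma part_eval_diff: "part_eval a g (p - q) = part_eval a g p - part_eval a g q"
  using part_eval_add[of p "smult (of_real (-1)) q"] part_eval_smult[of "-1" q] by simp

lemma part_eval_pCons_0: "part_eval a g (pCons 0 p) = m a (part_eval a g p)"
proof -
  have "part_eval a g (pCons 0 p) = (\<Sum>i\<le>Suc (degree p). g (coeff (pCons 0 p) i) *\<^sub>R (m a ^^ i) a)"
    by (rule part_eval_upto) (simp add: degree_pCons_le)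
  also have "\<dots> = (\<Sum>i\<le>degree p. g (coeff p i) *\<^sub>R m a ((m a ^^ i) a))"
    by (simp add: sum.atMost_Suc_shift linear_0[OF g] del: sum.atMost_Suc)
  also have "\<dots> = m a (part_eval a g p)"
  proof -
    have "linear (m a)" using bil by (simp add: bilinear_def)
    then show ?thesis by (simp add: part_eval_def linear_sum linear_scale)
  qed
  finally show ?thesis .
qed

text \<open>A single factor t - z mixes real and imaginary parts. Its product with the conjugate
  factor has real coefficients and acts on each part separately, as a real quadratic polynomial in
  left multiplication by a.\<close>

lemma part_eval_quadratic:
  "part_eval a g ([:- cnj z, 1:] * ([:- z, 1:] * p)) = m a (m a (part_eval a g p))
    - (2 * Re z) *\<^sub>R m a (part_eval a g p) + (cmod z)\<^sup>2 *\<^sub>R part_eval a g p"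
proof -
  have "[:- cnj z, 1:] * [:- z, 1:] = [:of_real ((cmod z)\<^sup>2), - of_real (2 * Re z), 1:]"
    by (simp add: complex_eq_iff cmod_power2 flip: power2_eq_square)
  then have "[:- cnj z, 1:] * ([:- z, 1:] * p) = [:of_real ((cmod z)\<^sup>2), - of_real (2 * Re z), 1:] * p"
    by (simp only: mult.assoc[symmetric])
  then have "[:- cnj z, 1:] * ([:- z, 1:] * p) = pCons 0 (pCons 0 p)
      - smult (of_real (2 * Re z)) (pCons 0 p) + smult (of_real ((cmod z)\<^sup>2)) p"
    by (simp del: of_real_power of_real_mult)
  then show ?thesis
    by (simp only: part_eval_add part_eval_diff part_eval_smult part_eval_pCons_0)
qed

lemma part_eval_in: "part_eval a g p \<in> alg_generated m {a}"
proof -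
  have "(m a ^^ i) a \<in> alg_generated m {a}" for i
    by (induction i) (simp_all add: alg_generated_base alg_generated_mult)
  then show ?thesis unfolding part_eval_def
    by (intro subspace_sum subspace_scale subspace_alg_generated)
qed

end

lemma linear_Re: "linear Re" and linear_Im: "linear Im"
  by (auto intro!: linearI)

lemma part_eval_smult_ii:
  "part_eval a Re (smult \<i> p) = - part_eval a Im p"
  "part_eval a Im (smult \<i> p) = part_eval a Re p"
  by (simp_all add: part_eval_upto[OF linear_Re, of "smult \<i> p" "degree p"]
      part_eval_upto[OF linear_Im, of "smult \<i> p" "degree p"] part_eval_def sum_negf degree_smult_le)

text \<open>Without a unit, a^2 - \<alpha> a + \<gamma> is only an operator. One more factor a turns
  it into an element, to which conditions on zero-divisors apply.\<close>

lemma cubic_factor: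
  assumes pa: "power_associative m" and w: "w \<in> alg_generated m {a}"
  shows "m (m a (m a a) - \<alpha> *\<^sub>R m a a + \<gamma> *\<^sub>R a) w = m a (m a (m a w) - \<alpha> *\<^sub>R m a w + \<gamma> *\<^sub>R w)"
proof -
  have "a \<in> alg_generated m {a}" by (simp add: alg_generated_base)
  then have "m (m a a) w = m a (m a w)" "m (m a (m a a)) w = m a (m a (m a w))"
    using power_associativeD[OF pa, of _ a] w by (simp_all add: alg_generated_mult)
  then show ?thesis by simp
qed

lemma algebraic_annihilator:
  assumes "algebraic_algebra m"
  obtains p where "p \<noteq> 0" "part_eval a Re p = 0" "part_eval a Im p = 0"
proof -
  obtain B where B: "finite B" "alg_generated m {a} \<subseteq> span B"
    using assms unfolding algebraic_algebra_def by blast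
  let ?f = "\<lambda>i. (m a ^^ i) a"
  define n where "n = card B"
  have f_in: "?f i \<in> span B" for i
  proof -
    have "?f i \<in> alg_generated m {a}"
      by (induction i) (simp_all add: alg_generated_base alg_generated_mult)
    then show ?thesis using B by blast
  qed
  have "\<exists>c. (\<exists>i\<le>n. c i \<noteq> (0::real)) \<and> (\<Sum>i\<le>n. c i *\<^sub>R ?f i) = 0"
  proof (cases "inj_on ?f {..n}")
    case False
    then obtain i k where ik: "i \<le> n" "k \<le> n" "i \<noteq> k" "?f i = ?f k" by (auto simp: inj_on_def)
    define c where "c l = (if l = i then 1 else if l = k then -1 else (0::real))" for l
    have "(\<Sum>l\<le>n. c l *\<^sub>R ?f l) = (\<Sum>l\<in>{i,k}. c l *\<^sub>R ?f l)"
      by (rule sum.mono_neutral_right) (use ik in \<open>auto simp: c_def\<close>)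
    also have "\<dots> = 0" using ik by (simp add: c_def)
    finally show ?thesis using ik by (intro exI[of _ c]) (auto simp: c_def)
  next
    case True
    then have "card (?f ` {..n}) = Suc n" by (simp add: card_image)
    then have "dependent (?f ` {..n})"
      using independent_span_bound[OF B(1), of "?f ` {..n}"] f_in n_def by fastforce
    then obtain u where u: "\<exists>v\<in>?f ` {..n}. u v \<noteq> 0" "(\<Sum>v\<in>?f ` {..n}. u v *\<^sub>R v) = 0"
      using dependent_finite[of "?f ` {..n}"] by auto
    then show ?thesis using sum.reindex[OF True, of "\<lambda>v. u v *\<^sub>R v"]
      by (intro exI[of _ "\<lambda>i. u (?f i)"]) auto
  qed
  then obtain c i where c: "i \<le> n" "c i \<noteq> (0::real)" "(\<Sum>i\<le>n. c i *\<^sub>R ?f i) = 0" by blast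
  define p where "p = (\<Sum>i\<le>n. monom (complex_of_real (c i)) i)"
  have coeff: "coeff p k = (if k \<le> n then of_real (c k) else 0)" for k
    by (simp add: p_def coeff_sum)
  have "p \<noteq> 0" using c coeff[of i] by auto
  moreover have "degree p \<le> n" by (rule degree_le) (simp add: coeff)
  then have "part_eval a Re p = 0" "part_eval a Im p = 0"
    using c(3) by (simp_all add: part_eval_upto[OF linear_Re, of p n] part_eval_upto[OF linear_Im, of p n] coeff)
  ultimately show ?thesis using that by blast
qed

text \<open>Take an annihilating complex polynomial of least degree and split off a root z. By
  minimality the cofactor has a nonzero real or imaginary part w at a, and the cubic in a formed
  from z and its conjugate kills w; the zero-divisor condition makes this cubic vanish.\<close>

lemma cubic_if_algebraic:
  assumes pa: "power_associative m" and alg: "algebraic_algebra m"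
    and nzd: "\<forall>a b. m a b + m b a = 0 \<longrightarrow> a = 0 \<or> b = 0"
  shows "\<exists>\<alpha> \<gamma>. \<alpha>\<^sup>2 \<le> \<gamma> \<and> m a (m a a) = (2 * \<alpha>) *\<^sub>R m a a - \<gamma> *\<^sub>R a"
proof (cases "a = 0")
  case True
  then show ?thesis by (intro exI[of _ 0]) auto
next
  case False
  let ?P = "\<lambda>p. p \<noteq> 0 \<and> part_eval a Re p = 0 \<and> part_eval a Im p = 0"
  obtain p where p: "?P p" and minimal: "\<And>q. ?P q \<Longrightarrow> degree p \<le> degree q"
  proof -
    have "\<exists>p. ?P p" using algebraic_annihilator[OF alg, of a] by blast
    then show ?thesis using that exists_least_iff[of "\<lambda>n. \<exists>p. ?P p \<and> degree p = n"]
      by (metis (mono_tags, lifting) not_le)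
  qed
  \<comment> \<open>A constant evaluates to multiples of a, because \<open>part_eval\<close> carries
    an extra factor t.\<close>
  have "degree p \<noteq> 0"
  proof
    assume "degree p = 0"
    then have "Re (coeff p 0) = 0" "Im (coeff p 0) = 0" using p False by (auto simp: part_eval_def)
    with p \<open>degree p = 0\<close> show False by (metis complex_eq_iff leading_coeff_0_iff zero_complex.sel)
  qed
  then obtain z where "poly p z = 0"
    using fundamental_theorem_of_algebra[of p] by (auto simp: constant_degree)
  then obtain r where r: "p = [:- z, 1:] * r" by (auto simp: poly_eq_0_iff_dvd)
  with p have "r \<noteq> 0" by auto
  then have "degree p = Suc (degree r)" unfolding r by (subst degree_mult_eq) auto
  then have "part_eval a Re r \<noteq> 0 \<or> part_eval a Im r \<noteq> 0" using minimal[of r] \<open>r \<noteq> 0\<close> by auto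
  then obtain g where g: "linear g" "part_eval a g r \<noteq> 0" "g = Re \<or> g = Im"
    using linear_Re linear_Im by blast
  let ?w = "part_eval a g r"
  have lin: "part_eval a g ([:- cnj z, 1:] * p) = 0"
  proof -
    have 1: "part_eval a h (smult (cnj z) p) = 0" if "h = Re \<or> h = Im" for h
    proof -
      have "smult (cnj z) p = smult (of_real (Re z)) p - smult (of_real (Im z)) (smult \<i> p)"
        by (rule poly_eqI) (simp add: complex_eq_iff algebra_simps)
      then show ?thesis using that p
        by (auto simp: part_eval_diff part_eval_smult linear_Re linear_Im part_eval_smult_ii
            simp del: smult_smult)
    qed
    have "[:- cnj z, 1:] * p = pCons 0 p - smult (cnj z) p" by simp
    then show ?thesis using g 1[OF g(3)] p by (auto simp only: part_eval_diff part_eval_pCons_0 distribs diff_zero)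
  qed
  let ?c = "m a (m a a) - (2 * Re z) *\<^sub>R m a a + (cmod z)\<^sup>2 *\<^sub>R a"
  have "m a (m a ?w) - (2 * Re z) *\<^sub>R m a ?w + (cmod z)\<^sup>2 *\<^sub>R ?w = 0"
    using lin unfolding r part_eval_quadratic[OF g(1)] .
  then have cw: "m ?c ?w = 0"
    unfolding cubic_factor[OF pa part_eval_in[OF g(1)]] by simp
  have "?c \<in> alg_generated m {a}"
    by (intro subspace_add subspace_diff subspace_scale subspace_alg_generated alg_generated_mult
        alg_generated_base singletonI)
  then have "m ?w ?c = 0"
    using alg_generated_singleton_commute[OF pa _ part_eval_in[OF g(1)]] cw by metis
  then have "?c = 0" using nzd cw g(2) by (metis add_0_left)
  moreover have "(Re z)\<^sup>2 \<le> (cmod z)\<^sup>2" by (simp add: cmod_power2)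
  ultimately show ?thesis by (intro exI conjI) (auto simp: algebra_simps)
qed

end

section \<open>Approximate eigenvalues\<close>

definition lin :: "complex \<Rightarrow> complex poly" where
  "lin z = [:- z, 1:]"

lemma lin_mult: "lin z * p = pCons 0 p - smult z p"
  by (simp add: lin_def)

text \<open>The intended instance adds the norms of the real and the imaginary part of t p(t) at a
  fixed a. Such a sum is invariant under multiplication by i but in general not homogeneous for
  complex scalars, whence the factor 2 in \<open>scale_le\<close>. Nonzero polynomials may have
  value 0.\<close>

locale poly_seminorm =
  fixes \<nu> :: "complex poly \<Rightarrow> real" and C :: real
  assumes triangle: "\<nu> (p + q) \<le> \<nu> p + \<nu> q"
    and scale: "\<nu> (smult (of_real c) p) = \<bar>c\<bar> * \<nu> p"
    and rotate: "\<nu> (smult \<i> p) = \<nu> p"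
    and shift: "\<nu> (pCons 0 p) \<le> C * \<nu> p"
    and one: "\<nu> 1 > 0"
begin

lemma zero [simp]: "\<nu> 0 = 0"
  using scale[of 0 0] by simp

lemma minus [simp]: "\<nu> (- p) = \<nu> p"
  using scale[of "-1" p] by simp

lemma nonneg [simp]: "0 \<le> \<nu> p"
  using triangle[of p "- p"] by simp

lemma triangle_diff: "\<nu> (p - q) \<le> \<nu> p + \<nu> q"
  using triangle[of p "- q"] by simp

lemma minus_commute: "\<nu> (p - q) = \<nu> (q - p)"
  using minus[of "p - q"] by simp

lemma scale_le: "\<nu> (smult z p) \<le> 2 * cmod z * \<nu> p"
proof -
  have "smult z p = smult (of_real (Re z)) p + smult (of_real (Im z)) (smult \<i> p)"
    by (rule poly_eqI) (simp add: complex_eq_iff algebra_simps)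
  then have "\<nu> (smult z p) \<le> \<nu> (smult (of_real (Re z)) p) + \<nu> (smult (of_real (Im z)) (smult \<i> p))"
    by (metis triangle)
  also have "\<dots> = (\<bar>Re z\<bar> + \<bar>Im z\<bar>) * \<nu> p" by (simp only: scale rotate distrib_right)
  also have "\<dots> \<le> 2 * cmod z * \<nu> p"
    using abs_Re_le_cmod[of z] abs_Im_le_cmod[of z] by (intro mult_right_mono) auto
  finally show ?thesis .
qed

lemma C_nonneg: "0 \<le> C"
proof -
  have "0 \<le> C * \<nu> 1" by (rule order_trans[OF nonneg shift])
  then show ?thesis using one by (simp add: zero_le_mult_iff)
qed

lemma lin_le: "\<nu> (lin z * p) \<le> (C + 2 * cmod z) * \<nu> p"
  using triangle_diff[of "pCons 0 p" "smult z p"] shift[of p] scale_le[of z p]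
  unfolding lin_mult by (simp add: distrib_right)

lemma lin_diff: "lin z * p - lin w * p = smult (w - z) p"
  unfolding lin_mult by (simp add: smult_diff_left)

text \<open>A substitute for surjectivity: without completeness, preimages can only be
  approximated.\<close>

definition dense_mult :: "complex poly \<Rightarrow> bool" where
  "dense_mult P \<longleftrightarrow> (\<forall>q. \<forall>\<epsilon>>0. \<exists>p. \<nu> (P * p - q) < \<epsilon>)"

text \<open>Solving again for the residual shrinks it by \<theta> each time: a Neumann iteration
  stopped after finitely many steps.\<close>

lemma dense_mult_if_contracting:
  assumes \<theta>: "0 \<le> \<theta>" "\<theta> < 1" and P: "\<And>q. \<exists>p. \<nu> (P * p - q) \<le> \<theta> * \<nu> q"
  shows "dense_mult P"
  unfolding dense_mult_def
proof (intro allI impI)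
  fix q and \<epsilon> :: real assume "\<epsilon> > 0"
  have iter: "\<exists>p. \<nu> (P * p - q) \<le> \<theta> ^ n * \<nu> q" for n
  proof (induction n)
    case 0
    have "\<nu> (P * 0 - q) \<le> \<theta> ^ 0 * \<nu> q" by simp
    then show ?case by blast
  next
    case (Suc n)
    then obtain p where p: "\<nu> (P * p - q) \<le> \<theta> ^ n * \<nu> q" by blast
    obtain p' where p': "\<nu> (P * p' - (q - P * p)) \<le> \<theta> * \<nu> (q - P * p)" using P by blast
    have "\<nu> (P * (p + p') - q) = \<nu> (P * p' - (q - P * p))" by (simp add: algebra_simps)
    also have "\<dots> \<le> \<theta> * (\<theta> ^ n * \<nu> q)"
      using p' mult_left_mono[OF p \<theta>(1)] by (simp add: minus_commute)
    finally show ?case by (intro exI[of _ "p + p'"]) simp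
  qed
  obtain n where "\<theta> ^ n < \<epsilon> / (\<nu> q + 1)"
    using real_arch_pow_inv[of "\<epsilon> / (\<nu> q + 1)" \<theta>] \<theta> \<open>\<epsilon> > 0\<close>
    by (auto simp: add_nonneg_pos)
  then have "\<theta> ^ n * (\<nu> q + 1) < \<epsilon>" by (simp add: pos_less_divide_eq add_nonneg_pos)
  moreover have "\<theta> ^ n * \<nu> q \<le> \<theta> ^ n * (\<nu> q + 1)" using \<theta> by (intro mult_left_mono) auto
  moreover obtain p where "\<nu> (P * p - q) \<le> \<theta> ^ n * \<nu> q" using iter by blast
  ultimately show "\<exists>p. \<nu> (P * p - q) < \<epsilon>" by (intro exI[of _ p]) linarith
qed

lemma dense_mult_prod:
  assumes "finite A" "\<And>k. k \<in> A \<Longrightarrow> dense_mult (lin (l k))"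
  shows "dense_mult (\<Prod>k\<in>A. lin (l k))"
  using assms
proof (induction A rule: finite_induct)
  case empty
  have "\<nu> (1 * q - q) < \<epsilon>" if "\<epsilon> > 0" for q and \<epsilon> :: real using that by simp
  then show ?case unfolding dense_mult_def by (metis prod.empty)
next
  case (insert k A)
  let ?Q = "\<Prod>k\<in>A. lin (l k)" and ?X = "lin (l k)"
  show ?case unfolding dense_mult_def
  proof (intro allI impI)
    fix q and \<epsilon> :: real assume "\<epsilon> > 0"
    define K where "K = C + 2 * cmod (l k) + 1"
    have "K > 0" using C_nonneg by (simp add: K_def add_nonneg_pos)
    obtain p1 where p1: "\<nu> (?X * p1 - q) < \<epsilon> / 2"
      using insert.prems[of k] \<open>\<epsilon> > 0\<close> unfolding dense_mult_def by (meson half_gt_zero insertI1)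
    have "\<epsilon> / (2 * K) > 0" using \<open>\<epsilon> > 0\<close> \<open>K > 0\<close> by simp
    then obtain p2 where p2: "\<nu> (?Q * p2 - p1) < \<epsilon> / (2 * K)"
      using insert.IH insert.prems unfolding dense_mult_def by blast
    have "\<nu> (?X * (?Q * p2 - p1)) \<le> K * \<nu> (?Q * p2 - p1)"
      using lin_le[of "l k" "?Q * p2 - p1"] nonneg[of "?Q * p2 - p1"]
      unfolding K_def by (simp add: distrib_right del: nonneg)
    also have "\<dots> < \<epsilon> / 2" using p2 \<open>K > 0\<close> by (simp add: field_simps)
    finally have "\<nu> (?X * (?Q * p2 - p1)) < \<epsilon> / 2" .
    moreover have eq: "(\<Prod>k\<in>insert k A. lin (l k)) * p2 - q = ?X * (?Q * p2 - p1) + (?X * p1 - q)"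
      using insert.hyps by (simp only: prod.insert right_diff_distrib mult.assoc) simp
    have "\<nu> ((\<Prod>k\<in>insert k A. lin (l k)) * p2 - q) \<le> \<nu> (?X * (?Q * p2 - p1)) + \<nu> (?X * p1 - q)"
      unfolding eq by (rule triangle)
    ultimately show "\<exists>p. \<nu> ((\<Prod>k\<in>insert k A. lin (l k)) * p - q) < \<epsilon>"
      using p1 by (intro exI[of _ p2]) linarith
  qed
qed

text \<open>If t - z were invertible, this would be the reciprocal of the norm of its inverse. The
  aim is a z with value 0.\<close>

definition lower :: "complex \<Rightarrow> real" where
  "lower z = Inf {\<nu> (lin z * p) |p. \<nu> p = 1}"

lemma normalized: "\<exists>p. \<nu> p = 1"
  using scale[of "1 / \<nu> 1" 1] one by (intro exI[of _ "smult (of_real (1 / \<nu> 1)) 1"]) simp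

lemma lower_greatest:
  assumes "\<And>p. \<nu> p = 1 \<Longrightarrow> c \<le> \<nu> (lin z * p)"
  shows "c \<le> lower z"
  unfolding lower_def by (rule cInf_greatest) (use assms normalized in blast)+

lemma lower_bound: "lower z * \<nu> p \<le> \<nu> (lin z * p)"
proof (cases "\<nu> p = 0")
  case False
  then have pos: "\<nu> p > 0" using nonneg[of p] by linarith
  let ?p = "smult (of_real (1 / \<nu> p)) p"
  have "\<nu> ?p = 1" using pos by (simp only: scale) simp
  then have in_set: "\<nu> (lin z * ?p) \<in> {\<nu> (lin z * p) |p. \<nu> p = 1}" by blast
  have "lower z \<le> \<nu> (lin z * ?p)"
    unfolding lower_def by (rule cInf_lower[OF in_set]) (auto intro!: bdd_belowI[of _ 0])
  also have "\<dots> = \<nu> (lin z * p) / \<nu> p"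
    using pos by (simp only: mult_smult_right scale) simp
  finally show ?thesis using pos by (simp add: field_simps)
qed simp

lemma lower_approx:
  assumes "\<eta> > 0"
  obtains p where "\<nu> p = 1" "\<nu> (lin z * p) < lower z + \<eta>"
proof -
  have "\<exists>y\<in>{\<nu> (lin z * p) |p. \<nu> p = 1}. y < lower z + \<eta>"
    by (rule cInf_lessD) (use normalized assms in \<open>auto simp flip: lower_def\<close>)
  then show ?thesis using that by blast
qed

lemma lower_lipschitz: "lower z \<le> lower w + 2 * cmod (z - w)"
proof -
  have "lower z - 2 * cmod (z - w) \<le> lower w"
  proof (rule lower_greatest)
    fix p assume p: "\<nu> p = 1"
    have "\<nu> (lin z * p) \<le> \<nu> (lin w * p) + \<nu> (smult (w - z) p)"
      using triangle[of "lin w * p" "smult (w - z) p"] lin_diff[of z p w]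
      by (simp only: diff_eq_eq) (simp add: add.commute)
    moreover have "\<nu> (smult (w - z) p) \<le> 2 * cmod (z - w)"
      using scale_le[of "w - z" p] p by (simp add: norm_minus_commute)
    ultimately show "lower z - 2 * cmod (z - w) \<le> \<nu> (lin w * p)"
      using lower_bound[of z p] p by simp
  qed
  then show ?thesis by simp
qed

lemma continuous_lower: "continuous_on S lower"
proof (rule continuous_onI)
  fix z \<epsilon> :: real and x assume "0 < \<epsilon>"
  show "\<exists>d>0. \<forall>y\<in>S. dist y x < d \<longrightarrow> dist (lower y) (lower x) \<le> \<epsilon>"
  proof (intro exI[of _ "\<epsilon>/2"] conjI ballI impI)
    fix y assume "dist y x < \<epsilon>/2"
    then show "dist (lower y) (lower x) \<le> \<epsilon>"
      using lower_lipschitz[of x y] lower_lipschitz[of y x]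
      by (simp add: dist_norm norm_minus_commute abs_le_iff)
  qed (use \<open>0 < \<epsilon>\<close> in simp)
qed

lemma lower_growth: "cmod z / 2 - C \<le> lower z"
proof (rule lower_greatest)
  fix p assume p: "\<nu> p = 1"
  show "cmod z / 2 - C \<le> \<nu> (lin z * p)"
  proof (cases "z = 0")
    case True
    then show ?thesis using order_trans[OF _ nonneg, of "- C"] C_nonneg by simp
  next
    case False
    have "1 \<le> 2 * cmod (1/z) * \<nu> (smult z p)"
      using scale_le[of "1/z" "smult z p"] p False by simp
    then have "cmod z / 2 \<le> \<nu> (smult z p)" using False by (simp add: norm_divide field_simps)
    also have "\<dots> \<le> \<nu> (pCons 0 p) + \<nu> (lin z * p)"
      using triangle_diff[of "pCons 0 p" "lin z * p"] unfolding lin_mult by simp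
    finally show ?thesis using shift[of p] p by simp
  qed
qed

text \<open>Growth at infinity yields a compact set of minimizers. Taking one with largest real part
  makes the inequality to its right strict, and this strictness later gives the
  contradiction.\<close>

lemma lower_minimum:
  obtains z where "\<And>w. lower z \<le> lower w" "\<And>r. r > 0 \<Longrightarrow> lower z < lower (z + of_real r)"
proof -
  define R where "R = 2 * (lower 0 + C) + 1"
  have far: "lower 0 < lower z" if "cmod z > R" for z
    using lower_growth[of z] that by (simp add: R_def)
  have "0 \<le> lower 0" by (rule lower_greatest) (rule nonneg)
  then have "0 \<in> cball (0::complex) R" using C_nonneg by (simp add: R_def)
  then obtain z1 where z1: "z1 \<in> cball 0 R" "\<And>w. w \<in> cball 0 R \<Longrightarrow> lower z1 \<le> lower w"
    using continuous_attains_inf[OF compact_cball _ continuous_lower] by blast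
  have min: "lower z1 \<le> lower w" for w
  proof (cases "w \<in> cball 0 R")
    case False
    then show ?thesis using far[of w] z1(2)[OF \<open>0 \<in> cball 0 R\<close>] by simp
  qed (rule z1(2))
  let ?M = "{z. lower z = lower z1}"
  have "?M \<subseteq> cball 0 R"
  proof
    fix z assume "z \<in> ?M"
    then show "z \<in> cball 0 R" using far[of z] min[of 0] by force
  qed
  moreover have "closed ?M"
    using closed_Collect_eq[OF continuous_lower[of UNIV] continuous_on_const] by simp
  ultimately have "compact ?M" using bounded_subset[OF bounded_cball] compact_eq_bounded_closed by blast
  then obtain z where z: "z \<in> ?M" "\<And>w. w \<in> ?M \<Longrightarrow> Re w \<le> Re z"
    using continuous_attains_sup[of ?M Re] continuous_on_Re[OF continuous_on_id] by blast
  show ?thesis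
  proof (rule that)
    show "lower z \<le> lower w" for w using z(1) min by simp
    show "lower z < lower (z + of_real r)" if "r > 0" for r
      using z(2)[of "z + of_real r"] z(1) min[of "z + of_real r"] that by fastforce
  qed
qed

text \<open>Injectivity with a uniform lower bound propagates density of the range along bounded steps,
  starting from a large \<open>z\<close> where the Neumann series converges.\<close>

lemma dense_mult_lin:
  assumes d: "d > 0" "\<And>w. d \<le> lower w"
  shows "dense_mult (lin z)"
proof -
  define D where "D = {z. dense_mult (lin z)}"
  \<comment> \<open>With residual 1/4, p has size at most 5/(4 d) times that of q. Moving z by d/8
    costs 2 * d/8 times this, that is 5/16; the total 9/16 is a contraction.\<close>
  have step: "w \<in> D" if "z \<in> D" "cmod (w - z) \<le> d / 8" for z w
  proof -
    have "\<exists>p. \<nu> (lin w * p - q) \<le> 9/16 * \<nu> q" for q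
    proof (cases "\<nu> q = 0")
      case True
      then show ?thesis by (intro exI[of _ 0]) simp
    next
      case False
      then have pos: "\<nu> q > 0" using nonneg[of q] by linarith
      then have "\<nu> q / 4 > 0" by simp
      then obtain p where p: "\<nu> (lin z * p - q) < \<nu> q / 4"
        using \<open>z \<in> D\<close> unfolding D_def dense_mult_def by blast
      have "d * \<nu> p \<le> lower z * \<nu> p" using d by (intro mult_right_mono) auto
      also have "\<dots> \<le> \<nu> (lin z * p)" by (rule lower_bound)
      also have "\<dots> \<le> 5/4 * \<nu> q"
        using triangle[of "lin z * p - q" q] p by simp
      finally have np: "d * \<nu> p \<le> 5/4 * \<nu> q" .
      have "\<nu> (smult (z - w) p) \<le> 2 * cmod (z - w) * \<nu> p" by (rule scale_le)
      also have "\<dots> \<le> (d / 4) * \<nu> p"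
        using that(2) by (intro mult_right_mono) (auto simp: norm_minus_commute)
      also have "\<dots> \<le> 5/16 * \<nu> q" using np by simp
      finally have "\<nu> (smult (z - w) p) \<le> 5/16 * \<nu> q" .
      moreover have eq: "lin w * p - q = (lin z * p - q) + smult (z - w) p"
        using lin_diff[of w p z] by (simp only: diff_eq_eq) (simp only: algebra_simps)
      have "\<nu> (lin w * p - q) \<le> \<nu> (lin z * p - q) + \<nu> (smult (z - w) p)"
        unfolding eq by (rule triangle)
      ultimately have "\<nu> (lin w * p - q) \<le> 9/16 * \<nu> q" using p by simp
      then show ?thesis by blast
    qed
    then show ?thesis unfolding D_def using dense_mult_if_contracting[of "9/16"] by simp
  qed
  \<comment> \<open>The step length d/8 is the same at every point, so D is both open and
    closed.\<close>
  have "open D"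
    unfolding open_dist
  proof
    fix z assume "z \<in> D"
    then show "\<exists>e>0. \<forall>y. dist y z < e \<longrightarrow> y \<in> D"
      using step d(1) by (intro exI[of _ "d/8"]) (auto simp: dist_norm)
  qed
  moreover have "closed D"
  proof -
    have "z \<in> D" if z: "z \<in> closure D" for z
    proof -
      have "d / 8 > 0" using d by simp
      then obtain y where "y \<in> D" "dist y z < d / 8" using z unfolding closure_approachable by blast
      then show ?thesis using step[of y z] by (simp add: dist_norm norm_minus_commute)
    qed
    then have "closure D = D" using closure_subset by blast
    then show ?thesis using closed_closure[of D] by simp
  qed
  \<comment> \<open>For the approximate solution -q/c the error is at most 2 C/c times the size of
    q, and c > 4 C makes this at most half of it.\<close>
  moreover define c where "c = 4 * C + 1"
  have "of_real c \<in> D"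
  proof -
    let ?z = "complex_of_real c"
    have c: "c > 0" "C \<le> c / 4" using C_nonneg by (simp_all add: c_def)
    then have z: "?z \<noteq> 0" "cmod ?z = c" by simp_all
    have "\<exists>p. \<nu> (lin ?z * p - q) \<le> 1/2 * \<nu> q" for q
    proof (intro exI)
      have eq: "lin ?z * smult (- 1 / ?z) q - q = smult (- 1 / ?z) (pCons 0 q)"
        unfolding lin_mult using z(1) by simp
      have "\<nu> (smult (- 1 / ?z) (pCons 0 q)) \<le> 2 * cmod (- 1 / ?z) * \<nu> (pCons 0 q)"
        by (rule scale_le)
      also have "\<dots> \<le> 2 * cmod (- 1 / ?z) * (C * \<nu> q)"
        by (intro mult_left_mono shift) auto
      also have "\<dots> = (2 * C / c) * \<nu> q" by (simp only: norm_divide z(2)) simp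
      also have "\<dots> \<le> 1/2 * \<nu> q" using c by (intro mult_right_mono) (auto simp: field_simps)
      finally show "\<nu> (lin ?z * smult (- 1 / ?z) q - q) \<le> 1/2 * \<nu> q" unfolding eq .
    qed
    then show ?thesis unfolding D_def using dense_mult_if_contracting[of "1/2"] by simp
  qed
  ultimately have "D = UNIV" using clopen by blast
  then show ?thesis by (auto simp: D_def)
qed

lemma prod_lower_bound:
  assumes "finite A" "0 \<le> d" "\<And>w. d \<le> lower w"
  shows "d ^ card A * \<nu> p \<le> \<nu> ((\<Prod>k\<in>A. lin (l k)) * p)"
  using assms(1)
proof (induction A rule: finite_induct)
  case (insert k A)
  let ?Q = "(\<Prod>k\<in>A. lin (l k)) * p"
  have "d ^ card (insert k A) * \<nu> p = d * (d ^ card A * \<nu> p)" using insert.hyps by simp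
  also have "\<dots> \<le> d * \<nu> ?Q" using insert.IH assms(2) by (rule mult_left_mono)
  also have "\<dots> \<le> lower (l k) * \<nu> ?Q" using assms(3) by (intro mult_right_mono) auto
  also have "\<dots> \<le> \<nu> (lin (l k) * ?Q)" by (rule lower_bound)
  also have "lin (l k) * ?Q = (\<Prod>k\<in>insert k A. lin (l k)) * p"
    using insert.hyps by (simp add: mult.assoc)
  finally show ?case .
qed simp

end

text \<open>Supplies the sample points of the mean. Only the root z + r is located explicitly; the
  fundamental theorem of algebra provides the others.\<close>

lemma power_diff_factorization:
  fixes z r :: complex
  assumes "n > 0"
  obtains l where "(\<Prod>k<n. lin (l k)) = lin z ^ n - [:r ^ n:]" "\<exists>k<n. l k = z + r"
proof -
  let ?p = "lin z ^ n - [:r ^ n:]"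
  have deg: "degree (lin z ^ n) = n" by (simp add: lin_def degree_linear_power)
  have "degree (lin z ^ n + - [:r ^ n:]) = n" using deg assms by (subst degree_add_eq_left) auto
  then have "degree ?p = n" by (simp only: diff_conv_add_uminus)
  moreover have "coeff (lin z ^ n) n = 1"
    using coeff_linear_power[of "- z" n] by (simp add: lin_def)
  then have "coeff ?p n = 1" using assms by (simp add: coeff_eq_0)
  ultimately obtain A where A: "size A = n" "?p = (\<Prod>x\<in>#A. lin x)"
    using alg_closed_imp_factorization[of ?p] assms unfolding lin_def[symmetric] by (metis leading_coeff_0_iff smult_1_left zero_neq_one)
  obtain xs where xs: "A = mset xs" by (metis ex_mset)
  have len: "length xs = n" using A xs by simp
  have prod: "(\<Prod>k<n. lin (xs ! k)) = ?p"
    using A(2) len unfolding xs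
    by (simp add: prod_mset_prod_list prod.list_conv_set_nth atLeast0LessThan flip: mset_map)
  have "poly ?p (z + r) = 0" by (simp add: lin_def poly_power)
  then have "(\<Prod>k<n. poly (lin (xs ! k)) (z + r)) = 0" unfolding prod[symmetric] poly_prod .
  then have "\<exists>k<n. xs ! k = z + r" by (auto simp: lin_def algebra_simps)
  with prod show ?thesis using that by blast
qed

context poly_seminorm
begin

text \<open>Otherwise \<open>lower\<close> would be positive with a minimum \<open>d\<close> at some \<open>z\<close>. Multiplication by
  \<open>t - w\<close> then behaves like an operator with inverse of norm \<open>1 / lower w\<close>, and
  \<open>(t - z)\<^sup>-\<^sup>1\<close> is, up to an error of order \<open>(r/d)\<^sup>n\<close>, the mean of the \<open>(t - w)\<^sup>-\<^sup>1\<close> over the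
  \<open>n\<close> roots \<open>w\<close> of \<open>(w - z)\<^sup>n = r\<^sup>n\<close>. One of these has a norm smaller than \<open>1/d\<close>, which gives a
  contradiction for large \<open>n\<close>.\<close>

theorem approximate_eigenvalue: "\<exists>z. \<forall>\<epsilon>>0. \<exists>p. \<nu> p = 1 \<and> \<nu> (lin z * p) < \<epsilon>"
proof -
  obtain z where z: "\<And>w. lower z \<le> lower w" "\<And>r. r > 0 \<Longrightarrow> lower z < lower (z + of_real r)"
    using lower_minimum by blast
  define d where "d = lower z"
  have "d \<le> 0"
  proof (rule ccontr)
    assume "\<not> d \<le> 0"
    then have d: "d > 0" by simp
    \<comment> \<open>Half of d makes the remainder (r/d)^n equal to (1/2)^n.\<close>
    define r where "r = d / 2"
    define d1 where "d1 = lower (z + of_real r)"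
    have d1: "d1 > d" using z(2)[of r] d by (simp add: d1_def d_def r_def)
    define \<rho> where "\<rho> = d / d1"
    have \<rho>: "0 < \<rho>" "\<rho> < 1" using d d1 by (auto simp: \<rho>_def)
    have "(\<lambda>n. real n * (1/2) ^ n) \<longlonglongrightarrow> 0" by (rule powser_times_n_limit_0) simp
    then have "eventually (\<lambda>n. real n * (1/2) ^ n < 1 - \<rho>) sequentially"
      using \<rho> by (intro order_tendstoD) auto
    then obtain n where n: "n > 0" "real n * (1/2) ^ n < 1 - \<rho>"
      using eventually_happens'[OF sequentially_bot eventually_conj[OF _ eventually_gt_at_top[of 0]]] by auto
    obtain l k0 where l: "(\<Prod>k<n. lin (l k)) = lin z ^ n - [:of_real r ^ n:]"
      and k0: "k0 < n" "l k0 = z + of_real r"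
      using power_diff_factorization[OF n(1), of z "of_real r"] by metis
    let ?P = "\<Prod>k<n. lin (l k)"
    \<comment> \<open>Differentiating the factorization says that the quotients of \<open>?P\<close>
      by its linear factors add up to n (t - z)^(n-1): in effect a mean of resolvents.\<close>
    have deriv: "(\<Sum>k<n. \<Prod>j\<in>{..<n} - {k}. lin (l j)) = smult (of_nat n) (lin z ^ (n - 1))"
    proof -
      have "pderiv ?P = (\<Sum>k<n. (\<Prod>j\<in>{..<n} - {k}. lin (l j)) * pderiv (lin (l k)))"
        by (rule pderiv_prod)
      moreover have "pderiv (lin z ^ n) = smult (of_nat n) (lin z ^ (n - 1) * pderiv (lin z))"
        by (rule pderiv_power)
      ultimately show ?thesis unfolding l by (simp add: pderiv_diff pderiv_pCons lin_def)
    qed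
    \<comment> \<open>The infimum and the inverse of \<open>?P\<close> are both only approximated,
      so the estimate holds up to \<eta>, which tends to 0 at the end.\<close>
    have key: "1 \<le> (d + 2 * \<eta>) * ((real n - 1 + \<rho>) / (real n * d) + (1/2) ^ n / d) + \<eta> / d"
      if \<eta>: "\<eta> > 0" for \<eta>
    proof -
      obtain x where x: "\<nu> x = 1" "\<nu> (lin z * x) < d + \<eta>"
        using lower_approx[OF \<eta>] unfolding d_def by blast
      define y where "y = lin z * x"
      have "dense_mult ?P"
        by (rule dense_mult_prod) (use dense_mult_lin[OF d] z(1) d_def in auto)
      then obtain v where v: "\<nu> (?P * v - y) < \<eta>" using \<eta> unfolding dense_mult_def by blast
      define y' where "y' = ?P * v"
      have y'y: "\<nu> (y' - y) < \<eta>" using v by (simp add: y'_def)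
      then have y': "\<nu> y' \<le> d + 2 * \<eta>"
        using triangle[of "y' - y" y] x(2) by (simp add: y_def)
      \<comment> \<open>\<open>s k\<close> plays the role of y' divided by t - l k.\<close>
      define s where "s k = (\<Prod>j\<in>{..<n} - {k}. lin (l j)) * v" for k
      have s: "lower (l k) * \<nu> (s k) \<le> \<nu> y'" if "k < n" for k
      proof -
        have "lin (l k) * s k = y'"
          unfolding s_def y'_def mult.assoc[symmetric]
          using prod.remove[of "{..<n}" k "\<lambda>j. lin (l j)"] that by simp
        then show ?thesis using lower_bound[of "l k" "s k"] by simp
      qed
      have s_le: "\<nu> (s k) \<le> \<nu> y' / d" if "k < n" for k
      proof -
        have "d * \<nu> (s k) \<le> lower (l k) * \<nu> (s k)" using z(1) by (intro mult_right_mono) (auto simp: d_def)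
        then show ?thesis using s[OF that] d by (simp add: field_simps)
      qed
      have s_k0: "\<nu> (s k0) \<le> \<nu> y' / d1"
        using s[OF k0(1)] d d1 unfolding k0(2) d1_def[symmetric] by (simp add: field_simps)
      \<comment> \<open>This is the mean of the \<open>s k\<close>. It approximates x, since (t -
        z)(x - w) is y - y' minus the remainder r^n v.\<close>
      define w where "w = lin z ^ (n - 1) * v"
      have "smult (of_real (real n)) w = (\<Sum>k<n. s k)"
        unfolding s_def w_def sum_distrib_right[symmetric] deriv by simp
      then have "real n * \<nu> w = \<nu> (\<Sum>k<n. s k)" using scale[of "real n" w] by simp
      also have "\<dots> \<le> (\<Sum>k<n. \<nu> (s k))"
      proof -
        have "\<nu> (sum s A) \<le> (\<Sum>k\<in>A. \<nu> (s k))" if "finite A" for A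
          using that by (induction A rule: finite_induct) (auto intro: order_trans[OF triangle])
        then show ?thesis by simp
      qed
      also have "\<dots> = \<nu> (s k0) + (\<Sum>k\<in>{..<n} - {k0}. \<nu> (s k))"
        using k0(1) by (simp add: sum.remove)
      also have "\<dots> \<le> \<nu> y' / d1 + (\<Sum>k\<in>{..<n} - {k0}. \<nu> y' / d)"
        by (intro add_mono s_k0 sum_mono s_le) simp
      also have "\<dots> = \<nu> y' / d1 + (real n - 1) * (\<nu> y' / d)" using k0(1) by (simp add: of_nat_diff)
      also have "\<dots> = \<nu> y' * ((real n - 1 + \<rho>) / d)" using d d1 by (simp add: \<rho>_def field_simps)
      finally have w: "\<nu> w \<le> \<nu> y' * ((real n - 1 + \<rho>) / (real n * d))"
        using n(1) d by (simp add: field_simps)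
      have "lin z * w = lin z ^ n * v"
        unfolding w_def mult.assoc[symmetric] power_Suc[symmetric] using n(1) by simp
      also have "\<dots> = y' + smult (of_real (r ^ n)) v"
        unfolding y'_def l by (simp add: left_diff_distrib)
      finally have zw: "lin z * (x - w) = (y - y') - smult (of_real (r ^ n)) v"
        unfolding right_diff_distrib by (simp add: y_def)
      have "d ^ n * \<nu> v \<le> \<nu> y'"
        using prod_lower_bound[of "{..<n}" d v l] d z(1) by (simp add: y'_def d_def)
      then have "r ^ n * \<nu> v \<le> (1/2) ^ n * \<nu> y'"
        by (simp add: r_def power_divide field_simps)
      moreover have "\<nu> (smult (of_real (r ^ n)) v) = r ^ n * \<nu> v"
        using d by (simp only: scale) (simp add: r_def)
      ultimately have "\<nu> (lin z * (x - w)) \<le> \<eta> + (1/2) ^ n * \<nu> y'"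
        using triangle_diff[of "y - y'" "smult (of_real (r ^ n)) v"] y'y
        unfolding zw by (simp add: minus_commute)
      moreover have "d * \<nu> (x - w) \<le> \<nu> (lin z * (x - w))"
        unfolding d_def by (rule lower_bound)
      ultimately have "d * \<nu> (x - w) \<le> \<eta> + (1/2) ^ n * \<nu> y'" by linarith
      then have "\<nu> (x - w) \<le> (\<eta> + (1/2) ^ n * \<nu> y') / d"
        using d by (simp add: pos_le_divide_eq mult.commute)
      then have "\<nu> (x - w) \<le> \<eta> / d + (1/2) ^ n / d * \<nu> y'"
        by (simp add: add_divide_distrib)
      then have "1 \<le> \<nu> y' * ((real n - 1 + \<rho>) / (real n * d) + (1/2) ^ n / d) + \<eta> / d"
        using triangle[of "x - w" w] x(1) w by (simp add: algebra_simps)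
      also have "\<dots> \<le> (d + 2 * \<eta>) * ((real n - 1 + \<rho>) / (real n * d) + (1/2) ^ n / d) + \<eta> / d"
        using y' n(1) d \<rho> by (intro add_right_mono mult_right_mono add_nonneg_nonneg divide_nonneg_pos) auto
      finally show ?thesis .
    qed
    define K where "K = (real n - 1 + \<rho>) / (real n * d) + (1/2) ^ n / d"
    have "((\<lambda>\<eta>. (d + 2 * \<eta>) * K + \<eta> / d) \<longlongrightarrow> (d + 2 * 0) * K + 0 / d) (at_right 0)"
      using d by (intro tendsto_intros) auto
    moreover have "eventually (\<lambda>\<eta>. 1 \<le> (d + 2 * \<eta>) * K + \<eta> / d) (at_right (0::real))"
      using key unfolding K_def by (auto simp: eventually_at_right_less eventually_at_filter)
    ultimately have "1 \<le> (d + 2 * 0) * K + 0 / d"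
      by (rule tendsto_lowerbound) simp
    moreover have "d * K = (real n - 1 + \<rho>) / real n + (1/2) ^ n"
      using d n(1) by (simp add: K_def field_simps)
    ultimately have "1 \<le> (real n - 1 + \<rho>) / real n + (1/2) ^ n" by simp
    then have "real n \<le> real n - 1 + \<rho> + real n * (1/2) ^ n"
      using n(1) by (simp add: field_simps)
    with n show False by linarith
  qed
  then have "\<exists>p. \<nu> p = 1 \<and> \<nu> (lin z * p) < \<epsilon>" if "\<epsilon> > 0" for \<epsilon>
    using lower_approx[OF that, of z] d_def by (metis add_le_cancel_right add_0 order_less_le_trans)
  then show ?thesis by blast
qed

end

section \<open>Normed algebras\<close>

lemma Metric_space_vs_norm: "vs_norm N \<Longrightarrow> Metric_space UNIV (\<lambda>x y. N (x - y))"
proof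
  assume N: "vs_norm N"
  note * = vs_normD[OF N]
  show "0 \<le> N (x - y)" "N (x - y) = 0 \<longleftrightarrow> x = y" for x y by (simp_all add: *(1,2))
  show "N (x - y) = N (y - x)" for x y using *(4)[of "-1" "x - y"] by simp
  show "N (x - z) \<le> N (x - y) + N (y - z)" for x y z using *(3)[of "x - y" "y - z"] by simp
qed

lemma limitin_norm_topology_0:
  assumes "vs_norm N"
  shows "limitin (norm_topology N) f 0 sequentially \<longleftrightarrow> (\<lambda>n. N (f n)) \<longlonglongrightarrow> 0"
proof -
  interpret Metric_space UNIV "\<lambda>x y. N (x - y)" using assms by (rule Metric_space_vs_norm)
  show ?thesis
    unfolding norm_topology_def limit_metric_sequentially
    by (simp add: LIMSEQ_def vs_normD(1)[OF assms])
qed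

lemma bounded_if_continuous_map:
  assumes N: "vs_norm N" and f: "linear f"
    and cont: "continuous_map (norm_topology N) (norm_topology N) f"
  shows "\<exists>C. \<forall>x. N (f x) \<le> C * N x"
proof -
  interpret Metric_space UNIV "\<lambda>x y. N (x - y)" using N by (rule Metric_space_vs_norm)
  note norm = vs_normD[OF N]
  have "openin mtopology {x \<in> topspace mtopology. f x \<in> mball 0 1}"
    using cont openin_continuous_map_preimage openin_mball unfolding norm_topology_def by blast
  moreover have "0 \<in> {x \<in> topspace mtopology. f x \<in> mball 0 1}"
    using linear_0[OF f] norm(2)[of 0] by simp
  ultimately obtain r where r: "r > 0" "mball 0 r \<subseteq> {x \<in> topspace mtopology. f x \<in> mball 0 1}"
    unfolding openin_mtopology by blast
  have neg: "N (- x) = N x" for x using norm(4)[of "-1" x] by simp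
  have small: "N (f x) < 1" if "N x < r" for x
    using r(2) that by (auto simp: neg mball_def)
  have "N (f x) \<le> (2 / r) * N x" for x
  proof (cases "x = 0")
    case True
    then show ?thesis using linear_0[OF f] norm(2)[of 0] by simp
  next
    case False
    then have pos: "N x > 0" using norm(1,2)[of x] by linarith
    let ?t = "r / (2 * N x)"
    have "N (?t *\<^sub>R x) < r" using pos r(1) by (simp add: norm(4))
    then have "?t * N (f x) < 1" using small[of "?t *\<^sub>R x"] pos r(1) by (simp add: linear_scale[OF f] norm(4))
    then show ?thesis using pos r(1) by (simp add: field_simps)
  qed
  then show ?thesis by blast
qed

context commutative_bilinear
begin

text \<open>An approximate eigenvalue \<open>z\<close> of multiplication by \<open>a\<close> on the subalgebra generated by \<open>a\<close>
  makes \<open>a (a - z) (a - cnj z)\<close> a topological zero-divisor.\<close>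

lemma cubic_if_bounded_below:
  assumes pa: "power_associative m" and N: "vs_norm N"
    and bounded: "\<And>a. \<exists>C. \<forall>x. N (m a x) \<le> C * N x"
    and below: "\<And>a. a \<noteq> 0 \<Longrightarrow> \<exists>c>0. \<forall>x. c * N x \<le> N (m a x)"
  shows "\<exists>\<alpha> \<gamma>. \<alpha>\<^sup>2 \<le> \<gamma> \<and> m a (m a a) = (2 * \<alpha>) *\<^sub>R m a a - \<gamma> *\<^sub>R a"
proof (cases "a = 0")
  case True
  then show ?thesis by (intro exI[of _ 0]) auto
next
  case False
  note norm = vs_normD[OF N]
  have neg: "N (- x) = N x" for x using norm(4)[of "-1" x] by simp
  obtain C where C: "\<And>x. N (m a x) \<le> C * N x" using bounded by blast
  have "0 \<le> C * N a" using norm(1)[of "m a a"] C[of a] by linarith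
  then have "C \<ge> 0" using False norm(1,2)[of a] by (simp add: zero_le_mult_iff)
  define \<nu> where "\<nu> p = N (part_eval a Re p) + N (part_eval a Im p)" for p
  note ev = part_eval_add[OF linear_Re] part_eval_add[OF linear_Im]
    part_eval_smult[OF linear_Re] part_eval_smult[OF linear_Im]
    part_eval_pCons_0[OF linear_Re] part_eval_pCons_0[OF linear_Im]
  interpret poly_seminorm \<nu> C
  proof
    fix p q :: "complex poly" and c :: real
    show "\<nu> (p + q) \<le> \<nu> p + \<nu> q"
      unfolding \<nu>_def ev using norm(3) by (smt (verit))
    show "\<nu> (smult (of_real c) p) = \<bar>c\<bar> * \<nu> p"
      by (simp add: \<nu>_def ev norm(4) distrib_left)
    show "\<nu> (smult \<i> p) = \<nu> p"
      by (simp add: \<nu>_def part_eval_smult_ii neg)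
    show "\<nu> (pCons 0 p) \<le> C * \<nu> p"
      unfolding \<nu>_def ev using C by (simp add: distrib_left add_mono)
    show "\<nu> 1 > 0" using False norm(1,2)[of a] norm(2)[of 0] by (simp add: \<nu>_def part_eval_def)
  qed
  obtain z where z: "\<And>\<epsilon>. \<epsilon> > 0 \<Longrightarrow> \<exists>p. \<nu> p = 1 \<and> \<nu> (lin z * p) < \<epsilon>"
    using approximate_eigenvalue by blast
  define c where "c = m a (m a a) - (2 * Re z) *\<^sub>R m a a + (cmod z)\<^sup>2 *\<^sub>R a"
  have "c = 0"
  proof (rule ccontr)
    assume "c \<noteq> 0"
    then obtain \<kappa> where \<kappa>: "\<kappa> > 0" "\<And>x. \<kappa> * N x \<le> N (m c x)" using below by blast
    \<comment> \<open>The element c factors formally as a (a - cnj z)(a - z), and K bounds the first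
      two factors. The 1 added to K below guards against K = 0.\<close>
    define K where "K = C * (C + 2 * cmod z)"
    have "K \<ge> 0" using \<open>C \<ge> 0\<close> by (simp add: K_def)
    have le: "\<kappa> * \<nu> p \<le> K * \<nu> (lin z * p)" for p
    proof -
      have c_eq: "m c (part_eval a g p) = m a (part_eval a g (lin (cnj z) * (lin z * p)))"
        if "linear g" for g
        unfolding c_def cubic_factor[OF pa part_eval_in[OF that]] lin_def part_eval_quadratic[OF that] ..
      have "\<kappa> * \<nu> p \<le> N (m c (part_eval a Re p)) + N (m c (part_eval a Im p))"
        unfolding \<nu>_def distrib_left by (intro add_mono \<kappa>(2))
      also have "\<dots> \<le> C * \<nu> (lin (cnj z) * (lin z * p))"
        unfolding c_eq[OF linear_Re] c_eq[OF linear_Im] \<nu>_def distrib_left by (intro add_mono C)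
      also have "\<dots> \<le> C * ((C + 2 * cmod (cnj z)) * \<nu> (lin z * p))"
        by (intro mult_left_mono lin_le \<open>C \<ge> 0\<close>)
      finally show ?thesis by (simp add: K_def mult.assoc)
    qed
    have "\<kappa> / (K + 1) > 0" using \<kappa> \<open>K \<ge> 0\<close> by simp
    then obtain p where "\<nu> p = 1" "\<nu> (lin z * p) < \<kappa> / (K + 1)" using z by blast
    then have "\<kappa> \<le> K * \<nu> (lin z * p)" "(K + 1) * \<nu> (lin z * p) < \<kappa>"
      using le[of p] \<open>K \<ge> 0\<close> by (simp_all add: field_simps)
    then show False using nonneg[of "lin z * p"] by (simp add: distrib_right del: nonneg)
  qed
  moreover have "(Re z)\<^sup>2 \<le> (cmod z)\<^sup>2" by (simp add: cmod_power2)
  ultimately show ?thesis unfolding c_def by (intro exI conjI) (auto simp: algebra_simps)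
qed

lemma naturally_R_or_C_if_bounded_below:
  assumes "\<exists>x::'a. x \<noteq> 0" "power_associative m" and N: "vs_norm N"
    and "\<And>a. \<exists>C. \<forall>x. N (m a x) \<le> C * N x"
    and below: "\<And>a. a \<noteq> 0 \<Longrightarrow> \<exists>c>0. \<forall>x. c * N x \<le> N (m a x)"
  shows "naturally_R_or_C m"
proof (rule naturally_R_or_C_if_cubic)
  show "\<forall>a b. m a b + m b a = 0 \<longrightarrow> a = 0 \<or> b = 0"
  proof (intro allI impI)
    fix a b assume "m a b + m b a = 0"
    then have "m a b = 0" by (simp add: comm[of b a] flip: scaleR_2)
    show "a = 0 \<or> b = 0"
    proof (cases "a = 0")
      case False
      then obtain c where "c > 0" "c * N b \<le> N (m a b)" using below by blast
      then have "N b \<le> 0" using \<open>m a b = 0\<close> vs_normD(2)[OF N, of 0] by (simp add: mult_le_0_iff)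
      then show ?thesis using vs_normD(1,2)[OF N, of b] by simp
    qed simp
  qed
  show "\<And>a. \<exists>\<alpha> \<gamma>. \<alpha>\<^sup>2 \<le> \<gamma> \<and> m a (m a a) = (2 * \<alpha>) *\<^sub>R m a a - \<gamma> *\<^sub>R a"
    by (rule cubic_if_bounded_below) fact+
qed fact+

lemma linear_mult: "linear (m a)"
  using bil by (simp add: bilinear_def)

text \<open>Each alternative bounds multiplication by a \<noteq> 0 from below. A continuous inverse
  is bounded; without a lower bound there are unit vectors b with a b arbitrarily small, and
  commutativity takes care of b a; supermultiplicativity gives the bound c N(a).\<close>

lemma naturally_R_or_C_normed:
  assumes nontrivial: "\<exists>x::'a. x \<noteq> 0" and pa: "power_associative m" and N: "vs_norm N"
    and sep: "separately_continuous (norm_topology N) m"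
    and cases: "one_sided_t_division (norm_topology N) m \<or>
      (\<forall>a. joint_topological_zero_divisor N m a \<longrightarrow> a = 0) \<or> (\<exists>c>0. supermultiplicative c N m)"
  shows "naturally_R_or_C m"
proof (rule naturally_R_or_C_if_bounded_below[OF nontrivial pa N])
  note norm = vs_normD[OF N]
  show "\<exists>C. \<forall>x. N (m a x) \<le> C * N x" for a
    using sep bounded_if_continuous_map[OF N linear_mult] by (simp add: separately_continuous_def)
  fix a :: 'a assume "a \<noteq> 0"
  then have "N a > 0" using norm(1,2)[of a] by linarith
  from cases show "\<exists>c>0. \<forall>x. c * N x \<le> N (m a x)"
  proof (elim disjE exE conjE)
    assume "one_sided_t_division (norm_topology N) m"
    then have "bij (m a) \<and> continuous_map (norm_topology N) (norm_topology N) (inv_into UNIV (m a))"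
    proof -
      have "(\<lambda>x. m x a) = m a" by (rule ext) (rule comm)
      then show ?thesis
        using \<open>one_sided_t_division (norm_topology N) m\<close> \<open>a \<noteq> 0\<close>
        unfolding one_sided_t_division_def by metis
    qed
    then have bij: "bij (m a)" and cont: "continuous_map (norm_topology N) (norm_topology N) (inv_into UNIV (m a))"
      by auto
    have left: "inv_into UNIV (m a) (m a x) = x" for x using bij by (simp add: bij_is_inj)
    have right: "m a (inv_into UNIV (m a) x) = x" for x using bij by (simp add: bij_is_surj surj_f_inv_f)
    have "linear (inv_into UNIV (m a))"
      by (rule linearI; rule injD[OF bij_is_inj[OF bij]]) (simp_all add: right)
    then obtain C where C: "\<And>x. N (inv_into UNIV (m a) x) \<le> C * N x"
      using bounded_if_continuous_map[OF N _ cont] by blast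
    have le: "N x \<le> C * N (m a x)" for x using C[of "m a x"] by (simp add: left)
    then have "C * N (m a a) > 0" using \<open>N a > 0\<close> order_less_le_trans by blast
    then have "C > 0" using norm(1)[of "m a a"] by (simp add: zero_less_mult_iff)
    then show ?thesis using le by (intro exI[of _ "1/C"]) (auto simp: field_simps)
  next
    assume "\<forall>a. joint_topological_zero_divisor N m a \<longrightarrow> a = 0"
    then have not_tzd: "\<not> joint_topological_zero_divisor N m a" using \<open>a \<noteq> 0\<close> by blast
    show ?thesis
    proof (rule ccontr)
      assume neg: "\<not> ?thesis"
      have "\<exists>b. N b = 1 \<and> N (m a b) < 1 / real (Suc n)" for n
      proof -
        obtain x where x: "\<not> 1 / real (Suc n) * N x \<le> N (m a x)"
          using neg by (metis of_nat_0_less_iff zero_less_Suc zero_less_divide_1_iff)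
        have "x \<noteq> 0" using x norm(2)[of 0] by auto
        then have "N x > 0" using norm(1,2)[of x] by linarith
        then show ?thesis using x
          by (intro exI[of _ "(1 / N x) *\<^sub>R x"]) (simp add: norm(4) field_simps)
      qed
      then obtain b where b: "\<And>n. N (b n) = 1" "\<And>n. N (m a (b n)) < 1 / real (Suc n)" by metis
      have "(\<lambda>n. N (m a (b n))) \<longlonglongrightarrow> 0"
        by (rule tendsto_sandwich[OF _ _ tendsto_const LIMSEQ_Suc[OF lim_1_over_n]])
          (use less_imp_le[OF b(2)] norm(1) in simp_all)
      then have "joint_topological_zero_divisor N m a"
        unfolding joint_topological_zero_divisor_def limitin_norm_topology_0[OF N]
        using b(1) comm[of a] by auto
      with not_tzd show False by blast
    qed
  next
    fix c :: real assume "c > 0" "supermultiplicative c N m"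
    then show ?thesis using \<open>N a > 0\<close>
      by (intro exI[of _ "c * N a"]) (simp add: supermultiplicative_def)
  qed
qed

lemma naturally_R_or_C_nearly_absolute_value:
  assumes "\<exists>x::'a. x \<noteq> 0" "power_associative m" and "nearly_absolute_value N m"
  shows "naturally_R_or_C m"
proof -
  obtain c where N: "vs_norm N" "\<And>a b. N (m a b) \<le> N a * N b" and c: "c > 0" "\<And>a b. c * N a * N b \<le> N (m a b)"
    using assms(3) unfolding nearly_absolute_value_def submultiplicative_def supermultiplicative_def by blast
  show ?thesis
  proof (rule naturally_R_or_C_if_bounded_below[OF assms(1,2) N(1)])
    show "\<exists>C. \<forall>x. N (m a x) \<le> C * N x" for a using N(2) by blast
    show "\<exists>c>0. \<forall>x. c * N x \<le> N (m a x)" if "a \<noteq> 0" for a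
      using that c vs_normD(1,2)[OF N(1), of a] by (intro exI[of _ "c * N a"]) (auto simp: less_le)
  qed
qed

end

section \<open>Quasi-division one-sided alternative algebras\<close>

locale left_alternative_algebra = real_bilinear +
  assumes left_alt: "left_alternative m"
begin

lemma alt: "m a (m a b) = m (m a a) b"
  using left_alt by (simp add: left_alternative_def)

lemma alt_linearized: "m x (m y z) + m y (m x z) = m (m x y + m y x) z"
  using alt[of "x + y" z] alt[of x z] alt[of y z] by (simp add: algebra_simps)

text \<open>Linearized left alternativity says that left multiplication preserves Jordan products.
  As 2 a (b a) is the Jordan polynomial a (ab + ba) + (ab + ba) a - (a^2 b + b a^2), the operator
  product for a, b, a is again a left multiplication.\<close>

lemma left_Moufang: "m (m a (m b a)) c = m a (m b (m a c))"
proof -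
  have inner: "m (m a b) a + m (m b a) a = m a (m b a) + m b (m a a)"
    using alt_linearized[of a b a] by simp
  have "2 *\<^sub>R m a (m b (m a c)) = m a (m (m a b + m b a) c) + m (m a b + m b a) (m a c)
      - (m (m a a) (m b c) + m b (m (m a a) c))"
    unfolding alt_linearized[symmetric] alt[symmetric] by (simp add: scaleR_2 algebra_simps)
  also have "\<dots> = m (m a (m a b + m b a) + m (m a b + m b a) a - (m (m a a) b + m b (m a a))) c"
    unfolding alt_linearized by (simp add: algebra_simps)
  also have "m a (m a b + m b a) + m (m a b + m b a) a - (m (m a a) b + m b (m a a)) = 2 *\<^sub>R m a (m b a)"
    using inner by (simp add: alt scaleR_2 algebra_simps)
  finally show ?thesis by simp
qed

text \<open>For A = \<open>m a\<close> and B = \<open>m b\<close>, the Moufang identity gives ABA =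
  A and BAB = B, and linearization gives AB + BA = 2. Multiplying the latter by AB on the right and
  by BA on the left yields AB = BAAB = BA, so both are the identity.\<close>

lemma bij_if_inverse:
  assumes unit: "alg_unit m e" and ab: "m a b = e" "m b a = e"
  shows "bij (m a)"
proof -
  have u: "m e x = x" "m x e = x" for x using unit by (simp_all add: alg_unit_def)
  have aba: "m a (m b (m a c)) = m a c" and bab: "m b (m a (m b c)) = m b c" for c
    using left_Moufang[of a b c] left_Moufang[of b a c] by (simp_all add: ab u)
  have sum: "m a (m b c) + m b (m a c) = 2 *\<^sub>R c" for c
    using alt_linearized[of a b c] by (simp add: ab u scaleR_2)
  have "m b (m a c) = m a (m b c)" for c
    using sum[of "m a (m b c)"] arg_cong[OF sum[of c], of "\<lambda>x. m b (m a x)"]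
    by (simp add: bab aba scaleR_2)
  then have "m a (m b c) = c" "m b (m a c) = c" for c
    using sum[of c] by (simp_all flip: scaleR_2)
  then show ?thesis by (intro o_bij[of "m b"]) auto
qed

lemma quasi_division_if_classical_division: "classical_division m \<Longrightarrow> quasi_division m"
  unfolding classical_division_def quasi_division_def alg_invertible_def
  using bij_if_inverse by blast

context
  assumes qd: "quasi_division m"
begin

lemma quasi_division_cases:
  assumes "a \<noteq> 0"
  obtains "inj (m a)" "surj (m a)" | "inj (\<lambda>x. m x a)" "surj (\<lambda>x. m x a)"
  using qd assms unfolding quasi_division_def bij_def by blast

text \<open>If \<open>m a z = 0\<close> and left multiplication by \<open>z\<close> is bijective, then \<open>z (a (z c)) = (z (a z)) c = 0\<close>
  shows that left multiplication by \<open>a\<close> vanishes.\<close>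

lemma quasi_division_no_zero_divisors:
  assumes "m a z = 0"
  shows "a = 0 \<or> z = 0"
proof (rule ccontr)
  assume "\<not> ?thesis"
  then have nz: "a \<noteq> 0" "z \<noteq> 0" by auto
  from nz(2) show False
  proof (cases rule: quasi_division_cases)
    case 1
    have "m z (m a (m z c)) = m z 0" for c
      using left_Moufang[of z a c] assms by simp
    then have "m a (m z c) = 0" for c using 1(1) by (blast dest: injD)
    then have "m a w = 0" for w using 1(2) by (metis surjD)
    then have "m a a = m a 0" "m a a = m 0 a" by simp_all
    from nz(1) show False
    proof (cases rule: quasi_division_cases)
      case 1
      then show False using injD[OF 1(1) \<open>m a a = m a 0\<close>] nz(1) by blast
    next
      case 2
      then show False using injD[OF 2(1), of a 0] \<open>m a a = m 0 a\<close> nz(1) by blast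
    qed
  next
    case 2
    have "m a z = m 0 z" using assms by simp
    then show False using injD[OF 2(1), of a 0] nz by simp
  qed
qed

lemma quasi_division_left_cancel: "a \<noteq> 0 \<Longrightarrow> m a x = m a y \<Longrightarrow> x = y"
  using quasi_division_no_zero_divisors[of a "x - y"] by simp

lemma quasi_division_right_cancel: "a \<noteq> 0 \<Longrightarrow> m x a = m y a \<Longrightarrow> x = y"
  using quasi_division_no_zero_divisors[of "x - y" a] by simp

lemma quasi_division_idempotent:
  fixes a :: 'a
  assumes "a \<noteq> 0"
  shows "\<exists>e. m e e = e \<and> e \<noteq> 0"
  using assms
proof (cases rule: quasi_division_cases)
  case 1
  obtain e where e: "m a e = a" using 1(2) by (metis surjD)
  \<comment> \<open>The rule (c e) e = c (e e) is not at hand, so ee = e is reached through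
    operators. With A = \<open>m a\<close> and E = \<open>m e\<close> one gets (1 - E) A (1 - E) =
    0; left multiplication by d = e - ee is E (1 - E), so d (a d) acts as zero.\<close>
  have eac: "m (m e a) c = m e (m a (m e c))" for c using left_Moufang[of e a c] e by simp
  have PAP: "m a c - m a (m e c) - m e (m a c - m a (m e c)) = 0" for c
    using alt_linearized[of a e c] by (simp add: e eac algebra_simps)
  define d where "d = e - m e e"
  have d: "m d w = m e (w - m e w)" for w by (simp add: d_def alt)
  have "m (m d (m a d)) c = 0" for c
  proof -
    have "m a (m d c) - m e (m a (m d c)) = 0"
      using PAP[of "m e c"] unfolding d[of c] by (simp only: distribs)
    then have "m d (m a (m d c)) = 0" unfolding d[of "m a (m d c)"] by simp
    then show ?thesis by (simp only: left_Moufang)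
  qed
  then have "m d (m a d) = 0" using quasi_division_no_zero_divisors assms by blast
  then have "d = 0" using quasi_division_no_zero_divisors assms by blast
  then have "m e e = e" by (simp add: d_def)
  moreover have "e \<noteq> 0" using e assms by auto
  ultimately show ?thesis by blast
next
  case 2
  obtain e where e: "m e a = a" using 2(2) by (metis surjD)
  have "m (m e e) a = m e a" using alt[of e a] e by simp
  then have "m e e = e" using quasi_division_right_cancel assms by blast
  moreover have "e \<noteq> 0" using e assms by auto
  ultimately show ?thesis by blast
qed

lemma quasi_division_idempotent_unit:
  assumes e: "m e e = e" "e \<noteq> 0"
  shows "alg_unit m e"
proof -
  have left: "m e x = x" for x
  proof -
    have "m e (m e x) = m e x" using alt[of e x] e by simp
    then show ?thesis using quasi_division_left_cancel e(2) by blast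
  qed
  have "m x e = x" for x
  proof -
    have "m (m x e) e = m x e" using alt_linearized[of e x e] by (simp add: left e)
    then show ?thesis using quasi_division_right_cancel e(2) by blast
  qed
  with left show ?thesis by (simp add: alg_unit_def)
qed

lemma classical_division_if_quasi_division:
  assumes "\<exists>x::'a. x \<noteq> 0"
  shows "classical_division m"
proof -
  obtain e where e: "m e e = e" "e \<noteq> 0" using assms quasi_division_idempotent by metis
  then have unit: "alg_unit m e" by (rule quasi_division_idempotent_unit)
  then have u: "m e x = x" "m x e = x" for x by (simp_all add: alg_unit_def)
  have "\<exists>b. m a b = e \<and> m b a = e" if "a \<noteq> 0" for a
    using that
  proof (cases rule: quasi_division_cases)
    case 1
    obtain b where b: "m a b = e" using 1(2) by (metis surjD)
    then have "b \<noteq> 0" using e by auto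
    \<comment> \<open>Here b (a b) = b, so cancelling b leaves a (b c) = c; the choice c = a turns
      the right inverse into a left one.\<close>
    have "m b (m a (m b c)) = m b c" for c using left_Moufang[of b a c] by (simp add: b u)
    then have "m a (m b a) = m a e" using quasi_division_left_cancel[OF \<open>b \<noteq> 0\<close>] u by metis
    then show ?thesis using quasi_division_left_cancel[OF that] b by blast
  next
    case 2
    obtain b where b: "m b a = e" using 2(2) by (metis surjD)
    then have "b \<noteq> 0" using e by auto
    have "m a (m b (m a c)) = m a c" for c using left_Moufang[of a b c] by (simp add: b u)
    then have "m b (m a b) = m b e" using quasi_division_left_cancel[OF that] u by metis
    then show ?thesis using quasi_division_left_cancel[OF \<open>b \<noteq> 0\<close>] b by blast
  qed
  moreover have "b = b'" if "m a b = e" "m a b' = e" for a b b'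
    using quasi_division_left_cancel[of a b b'] that e by force
  ultimately show ?thesis
    unfolding classical_division_def alg_invertible_def using unit by (metis (no_types, lifting))
qed

end

end

lemma quasi_division_iff_classical_division:
  fixes m :: "'a::real_vector \<Rightarrow> 'a \<Rightarrow> 'a"
  assumes m: "real_algebra m" "left_alternative m \<or> right_alternative m"
  shows "quasi_division m \<longleftrightarrow> classical_division m"
proof -
  have left: "quasi_division m \<longleftrightarrow> classical_division m"
    if "real_algebra m" "left_alternative m" for m :: "'a \<Rightarrow> 'a \<Rightarrow> 'a"
  proof -
    interpret left_alternative_algebra m
      using that by unfold_locales (auto simp: real_algebra_def)
    show ?thesis
      using quasi_division_if_classical_division classical_division_if_quasi_division that(1)
      unfolding real_algebra_def by blast
  qed
  \<comment> \<open>The opposite product is left alternative if the given one is right alternative,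
    and both division notions are invariant under this exchange.\<close>
  let ?op = "\<lambda>x y. m y x"
  have "quasi_division ?op \<longleftrightarrow> quasi_division m"
    unfolding quasi_division_def by (simp only: disj_commute)
  moreover have "classical_division ?op \<longleftrightarrow> classical_division m"
    unfolding classical_division_def alg_invertible_def alg_unit_def by (simp only: conj_commute)
  moreover have "left_alternative ?op" if "right_alternative m"
    using that by (simp add: left_alternative_def right_alternative_def)
  moreover have "real_algebra ?op" using m(1) by (auto simp: real_algebra_def bilinear_def)
  ultimately show ?thesis using left[of m] left[of ?op] m by blast
qed

section \<open>Associativity in the commutative alternative case\<close>

context commutative_bilinear
begin

text \<open>Commutativity leaves three bracketings u, v, w of x, y, z. Linearization at (x, y, z)
  and at (y, z, x) gives v + w = 2 u and w + u = 2 v, hence 3 (u - v) = 0.\<close>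

lemma assoc_if_alternative:
  assumes "left_alternative m \<or> right_alternative m"
  shows "m (m x y) z = m x (m y z)"
proof -
  have "left_alternative m"
    using assms unfolding left_alternative_def right_alternative_def by (metis comm)
  then interpret left_alternative_algebra m by unfold_locales
  have *: "m x (m y z) + m y (m x z) = 2 *\<^sub>R m (m x y) z" for x y z
    using alt_linearized[of x y z] by (simp add: comm[of y x] scaleR_2)
  define u where "u = m (m x y) z"
  define v where "v = m x (m y z)"
  define w where "w = m y (m x z)"
  have vw: "v + w = 2 *\<^sub>R u" using *[of x y z] by (simp add: u_def v_def w_def)
  have "m y (m z x) = w" "m z (m y x) = u" "m (m y z) x = v"
    by (simp_all add: u_def v_def w_def comm[of z] comm[of y x] comm[of "m y z" x])
  with *[of y z x] have wu: "w + u = 2 *\<^sub>R v" by simp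
  have "3 *\<^sub>R (u - v) = 2 *\<^sub>R u - 2 *\<^sub>R v + (u - v)"
    by (rule eq_by_functionals) (simp (no_asm_simp))
  also have "\<dots> = 0" unfolding vw[symmetric] wu[symmetric] by simp
  finally have "u = v" by simp
  then show ?thesis by (simp add: u_def v_def)
qed

end

section \<open>Topological division algebras\<close>

context commutative_bilinear
begin

text \<open>Covers both the inverse of x^2 - 2 Re z x + |z|^2 and that of its reversal, which
  describes the behaviour at infinity. The factor c is fixed because multiplication is only
  separately continuous.\<close>

lemma continuous_inverse_quadratic:
  fixes A B D :: "complex \<Rightarrow> real"
  assumes T: "topological_real_algebra T m" and f: "f \<in> topological_dual T"
    and unit: "alg_unit m e" and inv: "\<And>a. a \<noteq> 0 \<Longrightarrow> alg_invertible m e a"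
    and cont: "continuous_on UNIV A" "continuous_on UNIV B" "continuous_on UNIV D"
    and nz: "\<And>z. A z *\<^sub>R x + B z *\<^sub>R y + D z *\<^sub>R w \<noteq> 0"
  shows "continuous_on UNIV (\<lambda>z. f (m c (alg_inverse m e (A z *\<^sub>R x + B z *\<^sub>R y + D z *\<^sub>R w))))"
proof -
  have top: "topspace T = UNIV"
    and add: "continuous_map (prod_topology T T) T (\<lambda>(x, y). x + y)"
    and scale: "continuous_map (prod_topology euclideanreal T) T (\<lambda>(c, x). c *\<^sub>R x)"
    and mult: "continuous_map T T (m c)"
    and inverse: "continuous_map (subtopology T {a. alg_invertible m e a}) T (alg_inverse m e)"
    using T unit unfolding topological_real_algebra_def separately_continuous_def by auto
  have fcont: "continuous_map T euclideanreal f" using f by (simp add: topological_dual_def)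
  have term_cont: "continuous_map euclidean T (\<lambda>z. A z *\<^sub>R v)"
    if "continuous_on UNIV A" for A :: "complex \<Rightarrow> real" and v
  proof -
    have "continuous_map euclidean (prod_topology euclideanreal T) (\<lambda>z. (A z, v))"
      using that by (intro continuous_map_pairedI) (auto simp: top)
    from continuous_map_compose[OF this scale] show ?thesis by (simp add: o_def)
  qed
  have add_cont: "continuous_map euclidean T (\<lambda>z. g z + h z)"
    if "continuous_map euclidean T g" "continuous_map euclidean T h" for g h :: "complex \<Rightarrow> 'a"
    using continuous_map_compose[OF continuous_map_pairedI[OF that] add] by (simp add: o_def)
  have "continuous_map euclidean T (\<lambda>z. A z *\<^sub>R x + B z *\<^sub>R y + D z *\<^sub>R w)" (is "continuous_map _ _ ?p")
    by (intro add_cont term_cont cont)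
  then have "continuous_map euclidean (subtopology T {a. alg_invertible m e a}) ?p"
    using inv nz by (auto simp: continuous_map_in_subtopology)
  from continuous_map_compose[OF continuous_map_compose[OF continuous_map_compose[OF this inverse] mult] fcont]
  show ?thesis by (simp add: o_def)
qed

text \<open>Otherwise \<open>x - z\<close> has an inverse in the complexification for every complex \<open>z\<close>, namely
  \<open>x - cnj z\<close> times the inverse of \<open>x\<^sup>2 - 2 Re z x + |z|\<^sup>2\<close>, and Liouville's theorem applies to
  \<open>f\<close> of this resolvent for every \<open>f\<close> in the dual.\<close>

lemma quadratic_if_topological_division:
  assumes T: "topological_real_algebra T m" and dual: "dual_separates_points T"
    and assoc: "\<And>x y z. m (m x y) z = m x (m y z)"
    and unit: "alg_unit m e" and inv: "\<And>a. a \<noteq> 0 \<Longrightarrow> alg_invertible m e a" and "e \<noteq> 0"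
  shows "\<exists>\<alpha> \<gamma>. \<alpha>\<^sup>2 \<le> \<gamma> \<and> m x x = (2 * \<alpha>) *\<^sub>R x - \<gamma> *\<^sub>R e"
proof (rule ccontr)
  assume neg: "\<not> ?thesis"
  have u: "m e x = x" "m x e = x" for x using unit by (simp_all add: alg_unit_def)
  define k where "k = alg_inverse m e"
  have k: "m a (k a) = e" if "a \<noteq> 0" for a
    using theI'[OF inv[OF that, unfolded alg_invertible_def]] by (simp add: k_def alg_inverse_def)
  have k_unique: "b = k a" if "m a b = e" for a b
  proof -
    have "a \<noteq> 0" using that \<open>e \<noteq> 0\<close> by auto
    have "b = m b (m a (k a))" using k[OF \<open>a \<noteq> 0\<close>] by (simp add: u)
    also have "\<dots> = k a" using that by (simp add: u comm[of b a] flip: assoc)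
    finally show ?thesis .
  qed
  define q where "q z = 1 *\<^sub>R m x x + (- 2 * Re z) *\<^sub>R x + (cmod z)\<^sup>2 *\<^sub>R e" for z
  \<comment> \<open>The reversed polynomial, with q(z) = |z|^2 Q(1/z). Its value at 0 is the
    invertible e, so it controls the resolvent near infinity.\<close>
  define Q where "Q z = (cmod z)\<^sup>2 *\<^sub>R m x x + (- 2 * Re z) *\<^sub>R x + 1 *\<^sub>R e" for z
  have q_nz: "q z \<noteq> 0" for z
  proof
    assume "q z = 0"
    then have "m x x = (2 * Re z) *\<^sub>R x - (cmod z)\<^sup>2 *\<^sub>R e"
      by (simp add: q_def algebra_simps eq_neg_iff_add_eq_0)
    moreover have "(Re z)\<^sup>2 \<le> (cmod z)\<^sup>2" by (simp add: cmod_power2)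
    ultimately show False using neg by blast
  qed
  have Q_q: "q z = (cmod z)\<^sup>2 *\<^sub>R Q (inverse z)" if "z \<noteq> 0" for z
  proof -
    have "(cmod z)\<^sup>2 * (cmod (inverse z))\<^sup>2 = 1"
      using that by (simp add: norm_inverse flip: power_mult_distrib)
    moreover have "(cmod z)\<^sup>2 * (- 2 * Re (inverse z)) = - 2 * Re z"
    proof -
      have "(cmod z)\<^sup>2 * Re (inverse z) = Re z" using that by (simp add: cmod_power2 complex_eq_iff)
      then show ?thesis by (metis mult.left_commute)
    qed
    ultimately show ?thesis by (simp only: Q_def q_def scaleR_add_right scaleR_scaleR) simp
  qed
  have Q_nz: "Q z \<noteq> 0" for z
  proof (cases "z = 0")
    case True
    then show ?thesis using \<open>e \<noteq> 0\<close> by (simp add: Q_def)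
  next
    case False
    then show ?thesis using Q_q[of "inverse z"] q_nz[of "inverse z"] by auto
  qed
  have k_q: "k (q z) = (cmod (inverse z))\<^sup>2 *\<^sub>R k (Q (inverse z))" if "z \<noteq> 0" for z
  proof (rule k_unique[symmetric])
    have "(cmod z)\<^sup>2 * (cmod (inverse z))\<^sup>2 = 1"
      using that by (simp add: norm_inverse flip: power_mult_distrib)
    then show "m (q z) ((cmod (inverse z))\<^sup>2 *\<^sub>R k (Q (inverse z))) = e"
      using k[OF Q_nz] by (simp add: Q_q[OF that] mult.commute)
  qed
  \<comment> \<open>The imaginary part of g(i), for g defined below, is f of this inverse; a
    functional that does not vanish on it will contradict g = 0.\<close>
  have "k (q \<i>) \<noteq> 0" using k[OF q_nz[of \<i>]] \<open>e \<noteq> 0\<close> by auto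
  then obtain f where f: "f \<in> topological_dual T" "f (k (q \<i>)) \<noteq> f 0"
    using dual unfolding dual_separates_points_def by blast
  have lin: "linear f" using f(1) by (simp add: topological_dual_def)
  note f_simps = linear_add[OF lin] linear_diff[OF lin] linear_scale[OF lin] linear_0[OF lin] linear_neg[OF lin]
  have h_cont: "continuous_on UNIV (\<lambda>z. f (m c (k (q z))))" for c
    unfolding k_def q_def
    by (rule continuous_inverse_quadratic[OF T f(1) unit inv])
      (use q_nz in \<open>auto simp: q_def intro!: continuous_intros\<close>)
  have H_cont: "continuous_on UNIV (\<lambda>z. f (m c (k (Q z))))" for c
    unfolding k_def Q_def
    by (rule continuous_inverse_quadratic[OF T f(1) unit inv])
      (use Q_nz in \<open>auto simp: Q_def intro!: continuous_intros\<close>)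
  define g where "g z = of_real (f (m x (k (q z)))) - cnj z * of_real (f (k (q z)))" for z
  have "(g has_field_derivative
      (of_real (f (m (m x (m x (k (q w)))) (k (q w)))) - (cnj w + cnj w) * of_real (f (m (m x (k (q w))) (k (q w))))
        + cnj w * cnj w * of_real (f (m (k (q w)) (k (q w)))))) (at w)" for w
  proof -
    define d where "d = k (q w)"
    \<comment> \<open>F(z) is f of the product of the resolvents at z and w, so \<open>diff\<close>
      is the resolvent identity and F(w) is the derivative.\<close>
    define F where "F z = of_real (f (m (m x (m x d)) (k (q z)))) - (cnj z + cnj w) * of_real (f (m (m x d) (k (q z))))
      + cnj z * cnj w * of_real (f (m d (k (q z))))" for z
    have diff: "g z - g w = F z * (z - w)" for z
    proof -
      \<comment> \<open>All terms become real polynomials in x times this common factor, which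
        reduces the claim to an identity between complex numbers.\<close>
      define b where "b = m d (k (q z))"
      have "m (q w) b = m (m (q w) d) (k (q z))" by (simp add: b_def assoc)
      then have wb: "m (q w) b = k (q z)" using k[OF q_nz[of w]] by (simp add: d_def u)
      have "m (q z) b = m (m (q z) (k (q z))) d" by (simp add: b_def assoc comm[of d])
      then have "m (q z) b = d" using k[OF q_nz[of z]] by (simp add: u)
      with wb have kq: "k (q z) = m x (m x b) + (- 2 * Re w) *\<^sub>R m x b + (cmod w)\<^sup>2 *\<^sub>R b"
        and d: "d = m x (m x b) + (- 2 * Re z) *\<^sub>R m x b + (cmod z)\<^sup>2 *\<^sub>R b"
        by (simp_all add: q_def assoc u)
      have F: "F z = of_real (f (m x (m x b))) - (cnj z + cnj w) * of_real (f (m x b)) + cnj z * cnj w * of_real (f b)"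
        by (simp add: F_def b_def assoc)
      have gz: "g z = of_real (f (m x (m x (m x b))) - 2 * Re w * f (m x (m x b)) + (cmod w)\<^sup>2 * f (m x b))
          - cnj z * of_real (f (m x (m x b)) - 2 * Re w * f (m x b) + (cmod w)\<^sup>2 * f b)"
        unfolding g_def kq by (simp add: f_simps)
      have gw: "g w = of_real (f (m x (m x (m x b))) - 2 * Re z * f (m x (m x b)) + (cmod z)\<^sup>2 * f (m x b))
          - cnj w * of_real (f (m x (m x b)) - 2 * Re z * f (m x b) + (cmod z)\<^sup>2 * f b)"
        unfolding g_def d_def[symmetric] d by (simp add: f_simps)
      show ?thesis
        unfolding F gz gw cmod_power2 by (simp add: complex_eq_iff power2_eq_square algebra_simps)
    qed
    have "continuous_on UNIV F"
      unfolding F_def by (intro continuous_intros h_cont)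
    then have "isCont F w" by (simp add: continuous_on_eq_continuous_at)
    then have "(g has_field_derivative F w) (at w)" unfolding CARAT_DERIV using diff by blast
    then show ?thesis by (simp add: F_def d_def)
  qed
  then have hol: "g holomorphic_on UNIV"
    by (meson field_differentiable_def field_differentiable_at_within holomorphic_on_def)
  \<comment> \<open>This rewrites g(1/z) through Q, so it extends continuously to 0 with value 0.
    The factor e brings the second term into the form covered by \<open>H_cont\<close>.\<close>
  define G where "G z = of_real (f (m x (k (Q z)))) * of_real ((cmod z)\<^sup>2) - z * of_real (f (m e (k (Q z))))" for z
  have "continuous_on UNIV G"
    unfolding G_def by (intro continuous_intros H_cont)
  then have "(G \<longlongrightarrow> G 0) (at 0)"
    by (simp add: continuous_on_eq_continuous_at isContD)
  moreover have "eventually (\<lambda>z. G z = (g \<circ> inverse) z) (at 0)"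
  proof -
    have "(g \<circ> inverse) z = G z" if "z \<noteq> 0" for z
    proof -
      have "cnj (inverse z) * of_real ((cmod z)\<^sup>2) = z"
        using that complex_norm_square[of z] by (simp add: field_simps)
      then have "cnj (inverse z) * of_real ((cmod z)\<^sup>2 * f (k (Q z))) = z * of_real (f (k (Q z)))"
        by (simp only: of_real_mult flip: mult.assoc)
      then show ?thesis using k_q[of "inverse z"] that
        by (simp add: g_def G_def f_simps u del: complex_cnj_inverse)
    qed
    then show ?thesis by (auto simp: eventually_at_filter)
  qed
  ultimately have "((g \<circ> inverse) \<longlongrightarrow> 0) (at 0)"
    using Lim_transform_eventually[of G "G 0" "at 0" "g \<circ> inverse"] by (simp add: G_def)
  then have "(g \<longlongrightarrow> 0) at_infinity" by (simp add: lim_at_infinity_0)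
  then have "g \<i> = 0" using Liouville_weak[OF hol] by blast
  then have "f (k (q \<i>)) = 0" by (simp add: g_def complex_eq_iff)
  with f(2) show False by (simp add: f_simps)
qed

lemma naturally_R_or_C_topological:
  assumes T: "topological_real_algebra T m" and dual: "dual_separates_points T"
    and assoc: "\<And>x y z. m (m x y) z = m x (m y z)"
    and div: "classical_division m"
  shows "naturally_R_or_C m"
proof -
  obtain e where unit: "alg_unit m e" and inv: "\<And>a. a \<noteq> 0 \<Longrightarrow> alg_invertible m e a"
    using div unfolding classical_division_def by blast
  have u: "m e x = x" "m x e = x" for x using unit by (simp_all add: alg_unit_def)
  have nontrivial: "\<exists>x::'a. x \<noteq> 0" using T by (simp add: topological_real_algebra_def real_algebra_def)
  then have "e \<noteq> 0" using u(1) by (metis distribs(9))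
  show ?thesis
  proof (rule naturally_R_or_C_if_cubic[OF nontrivial])
    show "power_associative m" by (simp add: power_associative_def assoc)
    show "\<forall>a b. m a b + m b a = 0 \<longrightarrow> a = 0 \<or> b = 0"
    proof (intro allI impI)
      fix a b assume "m a b + m b a = 0"
      then have "m a b = 0" by (simp add: comm[of b a] flip: scaleR_2)
      show "a = 0 \<or> b = 0"
      proof (cases "a = 0")
        case False
        then obtain c where "m c a = e" using inv unfolding alg_invertible_def by blast
        then have "b = m c (m a b)" by (simp add: u flip: assoc)
        then show ?thesis using \<open>m a b = 0\<close> by simp
      qed simp
    qed
    fix x
    obtain \<alpha> \<gamma> where x: "\<alpha>\<^sup>2 \<le> \<gamma>" "m x x = (2 * \<alpha>) *\<^sub>R x - \<gamma> *\<^sub>R e"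
      using quadratic_if_topological_division[OF T dual assoc unit inv \<open>e \<noteq> 0\<close>] by blast
    have "m x (m x x) = (2 * \<alpha>) *\<^sub>R m x x - \<gamma> *\<^sub>R x"
      by (subst x(2)) (simp add: u)
    with x(1) show "\<exists>\<alpha> \<gamma>. \<alpha>\<^sup>2 \<le> \<gamma> \<and> m x (m x x) = (2 * \<alpha>) *\<^sub>R m x x - \<gamma> *\<^sub>R x" by blast
  qed
qed

end

section \<open>Absolute values and inner products\<close>

lemma power_dominated_imp_le:
  fixes x y :: real
  assumes "y > 0" "\<And>n. x ^ n \<le> c * y ^ n"
  shows "x \<le> y"
proof (rule ccontr)
  assume "\<not> x \<le> y"
  then have "1 < x / y" using assms(1) by simp
  then obtain n where "c < (x / y) ^ n" using real_arch_pow by blast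
  then show False using assms(2)[of n] assms(1) by (simp add: power_divide field_simps)
qed

lemma absolute_valueD:
  assumes "absolute_value N m"
  shows "vs_norm N" "N (m a b) = N a * N b"
  using assms by (simp_all add: absolute_value_def)

lemma absolute_value_real:
  fixes N :: "real \<Rightarrow> real"
  assumes "absolute_value N (*)"
  shows "N = norm"
proof
  fix x
  note norm = vs_normD[OF absolute_valueD(1)[OF assms]]
  have "N 1 = 1" using absolute_valueD(2)[OF assms, of 1 1] norm(2)[of 1] by simp
  then show "N x = norm x" using norm(4)[of x 1] by simp
qed

text \<open>The crude bound N(z) \<le> 2 |z| improves to N(z) \<le> |z| by taking powers; the
  reverse inequality follows from N(z) N(cnj z) = |z|^2.\<close>

lemma absolute_value_complex:
  fixes N :: "complex \<Rightarrow> real"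
  assumes "absolute_value N (*)"
  shows "N = norm"
proof
  note norm = vs_normD[OF absolute_valueD(1)[OF assms]] and mult = absolute_valueD(2)[OF assms]
  have N1: "N 1 = 1" using mult[of 1 1] norm(2)[of 1] by simp
  have "(N \<i>)\<^sup>2 = 1" using mult[of \<i> \<i>] norm(4)[of "-1" 1] N1 by (simp add: power2_eq_square)
  then have Ni: "N \<i> = 1" using norm(1)[of \<i>] by (simp add: power2_eq_1_iff) 
  have real: "N (of_real r) = \<bar>r\<bar>" for r
    using norm(4)[of r 1] N1 by (simp add: scaleR_conv_of_real)
  have pow: "N (z ^ n) = N z ^ n" for z n by (induction n) (simp_all add: N1 mult)
  have le: "N z \<le> cmod z" for z
  proof (cases "z = 0")
    case True
    then show ?thesis using norm(2)[of 0] by simp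
  next
    case False
    have "N w \<le> 2 * cmod w" for w
    proof -
      have "w = of_real (Re w) + of_real (Im w) * \<i>" by (simp add: complex_eq_iff)
      then have "N w \<le> N (of_real (Re w)) + N (of_real (Im w) * \<i>)" by (metis norm(3))
      also have "\<dots> = \<bar>Re w\<bar> + \<bar>Im w\<bar>" by (simp add: mult real Ni)
      finally show ?thesis using abs_Re_le_cmod[of w] abs_Im_le_cmod[of w] by linarith
    qed
    then have "N z ^ n \<le> 2 * cmod z ^ n" for n by (metis pow norm_power)
    then show ?thesis using False by (intro power_dominated_imp_le[of "cmod z" "N z" 2]) auto
  qed
  fix z
  show "N z = cmod z"
  proof (cases "z = 0")
    case True
    then show ?thesis using norm(2)[of 0] by simp
  next
    case False
    have "cmod z * cmod z = N (z * cnj z)"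
      using real[of "(cmod z)\<^sup>2"] by (simp add: complex_norm_square[symmetric] power2_eq_square)
    also have "\<dots> \<le> N z * cmod z"
      unfolding mult using le[of "cnj z"] norm(1)[of z] by (intro mult_left_mono) auto
    finally show ?thesis using False le[of z] by simp
  qed
qed

lemma absolute_value_transport:
  fixes \<phi> :: "'a::real_vector \<Rightarrow> 'b::real_normed_algebra"
  assumes N: "absolute_value N m" and \<phi>: "linear \<phi>" "bij \<phi>" "\<And>a b. \<phi> (m a b) = \<phi> a * \<phi> b"
    and unique: "\<And>N :: 'b \<Rightarrow> real. absolute_value N (*) \<Longrightarrow> N = norm"
  shows "N = (\<lambda>x. norm (\<phi> x))"
proof -
  note norm = vs_normD[OF absolute_valueD(1)[OF N]]
  define \<psi> where "\<psi> = inv_into UNIV \<phi>"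
  have [simp]: "\<phi> (\<psi> z) = z" "\<psi> (\<phi> x) = x" for z x
    using \<phi>(2) by (auto simp: \<psi>_def bij_is_surj surj_f_inv_f bij_is_inj)
  have inj: "x = y" if "\<phi> x = \<phi> y" for x y using that \<phi>(2) by (metis bij_pointE)
  have \<psi>: "\<psi> (x + y) = \<psi> x + \<psi> y" "\<psi> (c *\<^sub>R x) = c *\<^sub>R \<psi> x" "\<psi> (x * y) = m (\<psi> x) (\<psi> y)"
    for x y c by (rule inj, simp add: linear_add[OF \<phi>(1)] linear_scale[OF \<phi>(1)] \<phi>(3))+
  have \<psi>0: "\<psi> z = 0 \<longleftrightarrow> z = 0" for z
    using linear_0[OF \<phi>(1)] by (metis \<open>\<And>z. \<phi> (\<psi> z) = z\<close> \<open>\<And>x. \<psi> (\<phi> x) = x\<close>)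
  have "absolute_value (\<lambda>z. N (\<psi> z)) (*)"
    unfolding absolute_value_def vs_norm_def
    by (simp add: \<psi> \<psi>0 norm absolute_valueD(2)[OF N])
  from unique[OF this] show ?thesis by (metis \<open>\<And>x. \<psi> (\<phi> x) = x\<close>)
qed

text \<open>The usual absolute value is the only one on the reals and on the complex numbers;
  carried back by the isomorphism, this identifies a given absolute value with the natural
  norm.\<close>

lemma absolute_value_eq_isometric:
  assumes N: "absolute_value N m" and iso: "isometric_to_R_or_C m N'"
  shows "N = N'"
  using iso unfolding isometric_to_R_or_C_def isometric_isomorphism_def
proof (elim disjE exE conjE)
  fix \<phi> :: "'a \<Rightarrow> real"
  assume \<phi>: "linear \<phi>" "bij \<phi>" "\<forall>a b. \<phi> (m a b) = \<phi> a * \<phi> b" "\<forall>a. norm (\<phi> a) = N' a"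
  have "N = (\<lambda>x. norm (\<phi> x))"
    by (rule absolute_value_transport[OF N \<phi>(1,2)]) (use \<phi>(3) absolute_value_real in auto)
  then show ?thesis using \<phi>(4) by auto
next
  fix \<phi> :: "'a \<Rightarrow> complex"
  assume \<phi>: "linear \<phi>" "bij \<phi>" "\<forall>a b. \<phi> (m a b) = \<phi> a * \<phi> b" "\<forall>a. norm (\<phi> a) = N' a"
  have "N = (\<lambda>x. norm (\<phi> x))"
    by (rule absolute_value_transport[OF N \<phi>(1,2)]) (use \<phi>(3) absolute_value_complex in auto)
  then show ?thesis using \<phi>(4) by auto
qed

lemma commutative_if_injective_hom:
  fixes \<phi> :: "'a \<Rightarrow> 'b::comm_monoid_mult"
  assumes "inj \<phi>" "\<And>a b. \<phi> (m a b) = \<phi> a * \<phi> b"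
  shows "alg_commutative m"
  unfolding alg_commutative_def by (intro allI injD[OF assms(1)]) (simp add: assms(2) mult.commute)

lemma commutative_if_isometric: "isometric_to_R_or_C m N \<Longrightarrow> alg_commutative m"
  unfolding isometric_to_R_or_C_def isometric_isomorphism_def
  by (auto intro: commutative_if_injective_hom bij_is_inj)

context
  fixes B :: "'a::real_vector \<Rightarrow> 'a \<Rightarrow> real"
  assumes B: "real_inner_product B"
begin

lemma inner_simps:
  "B (x + y) z = B x z + B y z" "B x (y + z) = B x y + B x z"
  "B (x - y) z = B x z - B y z" "B x (y - z) = B x y - B x z"
  "B (c *\<^sub>R x) y = c * B x y" "B x (c *\<^sub>R y) = c * B x y"
  using B bilinear_ladd[of B] bilinear_radd[of B] bilinear_lsub[of B] bilinear_rsub[of B]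
    bilinear_lmul[of B] bilinear_rmul[of B]
  by (simp_all add: real_inner_product_def)

lemma inner_sym: "B x y = B y x" and inner_pos: "x \<noteq> 0 \<Longrightarrow> 0 < B x x"
  using B by (simp_all add: real_inner_product_def)

lemma inner_nonneg: "0 \<le> B x x"
proof (cases "x = 0")
  case True
  then show ?thesis using inner_simps(5)[of 0 x x] by simp
qed (simp add: inner_pos less_imp_le)

lemma inner_eq_0: "B x x = 0 \<longleftrightarrow> x = 0"
  using inner_pos[of x] inner_simps(5)[of 0 0 0] by (cases "x = 0") auto

lemma inner_Cauchy_Schwarz: "(B x y)\<^sup>2 \<le> B x x * B y y"
proof (cases "y = 0")
  case True
  then show ?thesis using inner_simps(6)[of x 0 y] inner_simps(5)[of 0 y y] by simp
next
  case False
  then have pos: "B y y > 0" by (rule inner_pos)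
  define t where "t = B x y / B y y"
  have "0 \<le> B (x - t *\<^sub>R y) (x - t *\<^sub>R y)" by (rule inner_nonneg)
  also have "\<dots> = B x x - 2 * t * B x y + t * (t * B y y)"
    by (simp add: inner_simps inner_sym[of y x] algebra_simps)
  also have "\<dots> = B x x - (B x y)\<^sup>2 / B y y"
    using pos by (simp add: t_def power2_eq_square field_simps)
  finally show ?thesis using pos by (simp add: field_simps)
qed

lemma inner_norm_square: "(inner_product_norm B x)\<^sup>2 = B x x"
  by (simp add: inner_product_norm_def inner_nonneg)

lemma vs_norm_inner_product_norm: "vs_norm (inner_product_norm B)"
  unfolding vs_norm_def
proof (intro conjI allI)
  fix x y and c :: real
  let ?N = "inner_product_norm B"
  show nonneg: "0 \<le> ?N x" for x by (simp add: inner_product_norm_def inner_nonneg)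
  show "?N x = 0 \<longleftrightarrow> x = 0" by (simp add: inner_product_norm_def inner_eq_0)
  show "?N (c *\<^sub>R x) = \<bar>c\<bar> * ?N x"
    by (simp add: inner_product_norm_def inner_simps real_sqrt_mult flip: mult.assoc)
  have "(B x y)\<^sup>2 \<le> (?N x * ?N y)\<^sup>2"
    using inner_Cauchy_Schwarz[of x y] by (simp add: power_mult_distrib inner_norm_square)
  then have "B x y \<le> ?N x * ?N y"
    by (rule power2_le_imp_le) (simp add: nonneg)
  then have "(?N (x + y))\<^sup>2 \<le> (?N x + ?N y)\<^sup>2"
    by (simp add: inner_norm_square power2_sum inner_simps inner_sym[of y x])
  then show "?N (x + y) \<le> ?N x + ?N y" by (rule power2_le_imp_le) (simp add: nonneg)
qed

end

context commutative_bilinear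
begin

text \<open>For unit vectors \<open>a\<close>, \<open>b\<close> put \<open>p = \<parallel>ab\<parallel>\<^sup>2\<close> and let \<open>s\<^sub>n\<close> be the inner product of the
  \<open>2\<^sup>n\<close>-th powers of \<open>a\<close> and \<open>b\<close>. The identity gives \<open>s\<^sub>n\<^sub>+\<^sub>1 = 1 + 2 s\<^sub>n\<^sup>2 - 2 p^(2^n)\<close>, and
  \<open>|s\<^sub>n| \<le> 1\<close> forces \<open>p = 1\<close>.\<close>

lemma absolute_value_if_square_norm:
  assumes B: "real_inner_product B" and sq: "\<And>a. inner_product_norm B (m a a) = (inner_product_norm B a)\<^sup>2"
    and assoc: "\<And>x y z. m (m x y) z = m x (m y z)"
  shows "absolute_value (inner_product_norm B) m"
proof -
  let ?N = "inner_product_norm B"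
  note Bs = inner_simps[OF B] and Bsym = inner_sym[OF B]
  have Bsq: "B (m a a) (m a a) = (B a a)\<^sup>2" for a
    using sq[of a] by (metis inner_norm_square[OF B])
  \<comment> \<open>Polarization: expanding the square identity at a + b and at a - b and adding
    leaves the terms of even degree in b; those of degree 0 and 4 cancel.\<close>
  have key: "2 * B (m a b) (m a b) = B a a * B b b + 2 * (B a b)\<^sup>2 - B (m a a) (m b b)" for a b
  proof -
    define s w u where "s = m a a" and "w = m a b" and "u = m b b"
    have "B (s + 2 *\<^sub>R w + u) (s + 2 *\<^sub>R w + u) = (B (a + b) (a + b))\<^sup>2"
      using Bsq[of "a + b"] by (simp add: s_def w_def u_def comm[of b a] scaleR_2 algebra_simps)
    moreover have "B (s - 2 *\<^sub>R w + u) (s - 2 *\<^sub>R w + u) = (B (a - b) (a - b))\<^sup>2"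
      using Bsq[of "a - b"] by (simp add: s_def w_def u_def comm[of b a] scaleR_2 algebra_simps)
    moreover have "B s s = (B a a)\<^sup>2" "B u u = (B b b)\<^sup>2" by (simp_all add: s_def u_def Bsq)
    ultimately have "B s u + 2 * B w w = B a a * B b b + 2 * (B a b)\<^sup>2"
      by (simp add: Bs Bsym[of b a] Bsym[of u s] Bsym[of w s] Bsym[of u w] power2_eq_square algebra_simps)
    then show ?thesis by (simp add: s_def w_def u_def)
  qed
  have unit_case: "B (m a b) (m a b) = 1" if unit: "B a a = 1" "B b b = 1" for a b
  proof -
    define q where "q x = m x x" for x
    define s where "s n = B ((q ^^ n) a) ((q ^^ n) b)" for n
    define p where "p = B (m a b) (m a b)"
    have qpow: "B ((q ^^ n) x) ((q ^^ n) x) = B x x ^ (2 ^ n)" for x n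
      by (induction n) (simp_all add: q_def Bsq mult.commute flip: power_mult)
    \<comment> \<open>Iterated squaring is multiplicative, so p^(2^n) is the squared norm of the
      product of the 2^n-th powers of a and b.\<close>
    have qmult: "(q ^^ n) (m a b) = m ((q ^^ n) a) ((q ^^ n) b)" for n
    proof (induction n)
      case (Suc n)
      have "q (m x y) = m (q x) (q y)" for x y
        unfolding q_def by (metis assoc comm)
      with Suc show ?case by simp
    qed simp
    have s_Suc: "s (Suc n) = 1 + 2 * (s n)\<^sup>2 - 2 * p ^ (2 ^ n)" for n
      using key[of "(q ^^ n) a" "(q ^^ n) b"]
      by (simp add: qpow unit s_def p_def flip: qmult) (simp add: q_def)
    have s_le: "(s n)\<^sup>2 \<le> 1" for n
      using inner_Cauchy_Schwarz[OF B, of "(q ^^ n) a" "(q ^^ n) b"] by (simp add: qpow unit s_def)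
    then have s_le': "\<bar>s n\<bar> \<le> 1" for n by (simp add: abs_square_le_1)
    have p_nonneg: "0 \<le> p" by (simp add: p_def inner_nonneg[OF B])
    have n_le: "n \<le> 2 ^ n" for n :: nat by (simp add: less_imp_le)
    \<comment> \<open>Once p^(2^n) > 2, the recursion gives \<open>s (Suc n)\<close> < 1 + 2 - 4 =
      -1.\<close>
    have "p \<le> 1"
    proof (rule ccontr)
      assume "\<not> p \<le> 1"
      then obtain n where n: "2 < p ^ n" using real_arch_pow[of p 2] by auto
      also have "p ^ n \<le> p ^ (2 ^ n)" using \<open>\<not> p \<le> 1\<close> n_le by (intro power_increasing) auto
      finally show False using s_Suc[of n] s_le[of n] s_le'[of "Suc n"] by linarith
    qed
    \<comment> \<open>Once p^(2^n) < 1/8, the recursion gives \<open>s (Suc n)\<close> \<ge> 3/4.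
      But the next value is at most 1, which forces the square of \<open>s (Suc n)\<close> below 1/8
      < 9/16.\<close>
    moreover have "\<not> p < 1"
    proof
      assume "p < 1"
      then obtain n where n: "p ^ n < 1/8" using real_arch_pow_inv[of "1/8" p] by auto
      have small: "p ^ (2 ^ k) < 1/8" if "n \<le> k" for k
      proof -
        have "p ^ (2 ^ k) \<le> p ^ n"
          using \<open>p < 1\<close> p_nonneg order_trans[OF that n_le] by (intro power_decreasing) auto
        with n show ?thesis by simp
      qed
      have "(s (Suc n))\<^sup>2 \<le> p ^ (2 ^ Suc n)"
        using s_Suc[of "Suc n"] s_le'[of "Suc (Suc n)"] by linarith
      then have "(s (Suc n))\<^sup>2 < 1/8" using small[of "Suc n"] by linarith
      moreover have "3/4 \<le> s (Suc n)"
        using s_Suc[of n] small[of n] zero_le_power2[of "s n"] by linarith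
      then have "(3/4)\<^sup>2 \<le> (s (Suc n))\<^sup>2" by (intro power_mono) auto
      ultimately show False by (simp add: power2_eq_square)
    qed
    ultimately show ?thesis by (simp add: p_def)
  qed
  have "?N (m a b) = ?N a * ?N b" for a b
  proof (cases "a = 0 \<or> b = 0")
    case True
    then show ?thesis using vs_normD(2)[OF vs_norm_inner_product_norm[OF B], of 0] by auto
  next
    case False
    note norm = vs_normD[OF vs_norm_inner_product_norm[OF B]]
    have pos: "?N a > 0" "?N b > 0" using False norm(1,2) by (simp_all add: less_le)
    have unit: "B ((1 / ?N x) *\<^sub>R x) ((1 / ?N x) *\<^sub>R x) = 1" if "?N x > 0" for x
    proof -
      have "B x x = ?N x * ?N x" using inner_norm_square[OF B, of x] by (simp add: power2_eq_square)
      then show ?thesis using that by (simp add: Bs)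
    qed
    have "B (m ((1 / ?N a) *\<^sub>R a) ((1 / ?N b) *\<^sub>R b)) (m ((1 / ?N a) *\<^sub>R a) ((1 / ?N b) *\<^sub>R b)) = 1"
      by (intro unit_case unit pos)
    then have "?N (m ((1 / ?N a) *\<^sub>R a) ((1 / ?N b) *\<^sub>R b)) = 1" by (simp add: inner_product_norm_def)
    then show ?thesis using pos by (simp add: norm(4) field_simps)
  qed
  then show ?thesis using vs_norm_inner_product_norm[OF B] by (simp add: absolute_value_def)
qed

end

lemma naturally_isometric_absolute_value:
  assumes N: "absolute_value N m" and nat: "naturally_R_or_C m"
  shows "isometric_to_R_or_C m N \<and> locally_complex m \<and> is_natural_norm m N"
proof -
  obtain N' where "is_natural_norm m N'" "isometric_to_R_or_C m N'"
    using nat unfolding naturally_R_or_C_def by blast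
  moreover have "N = N'" by (rule absolute_value_eq_isometric[OF N]) fact
  ultimately show ?thesis using nat unfolding naturally_R_or_C_def by simp
qed

theorem theorem5p3:
  fixes m :: "'a::real_vector \<Rightarrow> 'a \<Rightarrow> 'a"
  assumes "real_algebra m"
  shows
    "(algebraic_algebra m \<and> power_associative m \<longrightarrow>
        (alg_commutative m \<and> (\<forall>a. zero_divisor m a \<longrightarrow> a = 0) \<longrightarrow> naturally_R_or_C m) \<and>
        ((\<forall>a b. m a b + m b a = 0 \<longrightarrow> a = 0 \<or> b = 0) \<longrightarrow> naturally_R_or_C m))
     \<and>
     (power_associative m \<and> alg_commutative m \<and>
        ((\<exists>N. vs_norm N \<and> separately_continuous (norm_topology N) m \<and>
              one_sided_t_division (norm_topology N) m) \<or>
         (\<exists>N. vs_norm N \<and> separately_continuous (norm_topology N) m \<and>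
              (\<forall>a. joint_topological_zero_divisor N m a \<longrightarrow> a = 0)) \<or>
         (\<exists>N. vs_norm N \<and> (\<exists>c>0. supermultiplicative c N m) \<and>
              separately_continuous (norm_topology N) m) \<or>
         (\<exists>N. nearly_absolute_value N m))
        \<longrightarrow> naturally_R_or_C m)
     \<and>
     (\<forall>T. (left_alternative m \<or> right_alternative m) \<and>
          topological_real_algebra T m \<and> dual_separates_points T \<longrightarrow>
        (quasi_division m \<longleftrightarrow> classical_division m) \<and>
        (quasi_division m \<and> alg_commutative m \<longrightarrow> naturally_R_or_C m))
     \<and>
     (\<forall>B N. power_associative m \<and> real_inner_product B \<and> N = inner_product_norm B \<and>
          (\<forall>a. N (m a a) = (N a)\<^sup>2) \<and>
          alg_commutative m \<and> (left_alternative m \<or> right_alternative m) \<longrightarrow>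
        isometric_to_R_or_C m N \<and> locally_complex m \<and> is_natural_norm m N)
     \<and>
     (\<forall>N. power_associative m \<and> absolute_value N m \<longrightarrow>
        (isometric_to_R_or_C m N \<longleftrightarrow> alg_commutative m) \<and>
        (alg_commutative m \<longrightarrow> locally_complex m \<and> is_natural_norm m N))"
proof -
  have nontrivial: "\<exists>x::'a. x \<noteq> 0" using assms by (simp add: real_algebra_def)
  interpret real_bilinear m using assms by unfold_locales (simp add: real_algebra_def)
  have commutative: "commutative_bilinear m" if "alg_commutative m"
    using that by unfold_locales (simp add: alg_commutative_def)
  have i: "naturally_R_or_C m"
    if "algebraic_algebra m" "power_associative m" "\<forall>a b. m a b + m b a = 0 \<longrightarrow> a = 0 \<or> b = 0"
    using naturally_R_or_C_if_cubic[OF nontrivial that(2,3)] cubic_if_algebraic[OF that(2,1,3)] by blast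
  have i': "\<forall>a b. m a b + m b a = 0 \<longrightarrow> a = 0 \<or> b = 0"
    if "alg_commutative m" "\<forall>a. zero_divisor m a \<longrightarrow> a = 0"
  proof (intro allI impI)
    fix a b assume "m a b + m b a = 0"
    then have "2 *\<^sub>R m a b = 0" using that(1) by (simp add: scaleR_2 alg_commutative_def)
    then have "m a b = 0" by simp
    then show "a = 0 \<or> b = 0" using that(2) unfolding zero_divisor_def by blast
  qed
  have ii: "naturally_R_or_C m"
    if "power_associative m" "alg_commutative m"
      "(\<exists>N. vs_norm N \<and> separately_continuous (norm_topology N) m \<and>
              one_sided_t_division (norm_topology N) m) \<or>
         (\<exists>N. vs_norm N \<and> separately_continuous (norm_topology N) m \<and>
              (\<forall>a. joint_topological_zero_divisor N m a \<longrightarrow> a = 0)) \<or>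
         (\<exists>N. vs_norm N \<and> (\<exists>c>0. supermultiplicative c N m) \<and>
              separately_continuous (norm_topology N) m) \<or>
         (\<exists>N. nearly_absolute_value N m)"
    using that(3) commutative_bilinear.naturally_R_or_C_normed[OF commutative[OF that(2)] nontrivial that(1)]
      commutative_bilinear.naturally_R_or_C_nearly_absolute_value[OF commutative[OF that(2)] nontrivial that(1)]
    by (elim disjE exE conjE) blast+
  have iii: "(quasi_division m \<longleftrightarrow> classical_division m) \<and>
        (quasi_division m \<and> alg_commutative m \<longrightarrow> naturally_R_or_C m)"
    if alt: "left_alternative m \<or> right_alternative m"
      and T: "topological_real_algebra T m" "dual_separates_points T" for T
  proof -
    have "quasi_division m \<longleftrightarrow> classical_division m"
      by (rule quasi_division_iff_classical_division[OF assms alt])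
    moreover have "naturally_R_or_C m" if "classical_division m" "alg_commutative m"
    proof -
      interpret commutative_bilinear m using that(2) by (rule commutative)
      show ?thesis
        by (rule naturally_R_or_C_topological[OF T assoc_if_alternative[OF alt] that(1)])
    qed
    ultimately show ?thesis by blast
  qed
  have v: "isometric_to_R_or_C m N \<and> locally_complex m \<and> is_natural_norm m N"
    if "power_associative m" "absolute_value N m" "alg_commutative m" for N
  proof -
    have "nearly_absolute_value N m"
      using that(2) unfolding nearly_absolute_value_def absolute_value_def submultiplicative_def
        supermultiplicative_def by (auto intro!: exI[of _ 1])
    then have "naturally_R_or_C m" using ii[OF that(1,3)] by blast
    then show ?thesis by (rule naturally_isometric_absolute_value[OF that(2)])
  qed
  have iv: "isometric_to_R_or_C m N \<and> locally_complex m \<and> is_natural_norm m N"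
    if "power_associative m" "real_inner_product B" "N = inner_product_norm B"
      "\<forall>a. N (m a a) = (N a)\<^sup>2" "alg_commutative m" "left_alternative m \<or> right_alternative m" for B N
  proof (rule v[OF that(1) _ that(5)])
    interpret commutative_bilinear m using that(5) by (rule commutative)
    show "absolute_value N m"
      unfolding that(3)
      by (rule absolute_value_if_square_norm[OF that(2) _ assoc_if_alternative[OF that(6)]])
        (use that(3,4) in blast)
  qed
  show ?thesis
  proof (intro conjI allI impI; (elim conjE)?)
    show "naturally_R_or_C m"
      if "algebraic_algebra m" "power_associative m" "alg_commutative m" "\<forall>a. zero_divisor m a \<longrightarrow> a = 0"
      using i[OF that(1,2) i'[OF that(3,4)]] .
    show "naturally_R_or_C m"
      if "algebraic_algebra m" "power_associative m" "\<forall>a b. m a b + m b a = 0 \<longrightarrow> a = 0 \<or> b = 0"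
      using i[OF that] .
  qed (use ii iii iv v commutative_if_isometric in blast)+
qed

end
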